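(* Let $\mathcal{G}$ be a transitive topological groupoid with compact stabilizers, fix $b\in\mathcal{G}^0$, and suppose that $t|_{\mathcal{G}_b}\colon\mathcal{G}_b\to\mathcal{G}^0$ admits local sections. Let $\rho'\colon E\mathcal{G}\to B\mathcal{G}_b^b$ be the universal $\mathcal{G}$-bundle. Any principal $\mathcal{G}$-bundle $P\to M$ is isomorphic to a pullback of $\rho'\colon E\mathcal{G}\to B\mathcal{G}_b^b$ to $M$, and isomorphism classes of principal $\mathcal{G}$-bundles over $M$ are in bijection with homotopy classes of maps $M\to B\mathcal{G}_b^b$. Moreover, if $\mathcal{B}_{\mathcal{G}}(M)$ is the set of all isomorphism classes of principal $\mathcal{G}$-bundles over $M$ and $[M,B\mathcal{G}_b^b]$ is the set of all homotopy classes of maps $M\to B\mathcal{G}_b^b$, then the functors $\mathcal{B}_{\mathcal{G}}$ and $[\,\cdot\,,B\mathcal{G}_b^b]$ from spaces to sets are naturally isomorphic.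
   Context: All spaces are Hausdorff and compactly generated, and maps are continuous. A topological groupoid $\mathcal{G}$ has an object space $\mathcal{G}^0$ and an arrow space $\mathcal{G}^1$, both Hausdorff, with continuous structure maps (identity $i\colon\mathcal{G}^0\to\mathcal{G}^1$, source $s$, target $t$, inverse, and composition $gh:=g\circ h$, defined when $s(g)=t(h)$), and $s$ (hence $t$) is open. It is transitive if its orbit space $\mathcal{G}^0/\mathcal{G}^1$ is a single point. For $b\in\mathcal{G}^0$: $\mathcal{G}_b^b=\{g\mid s(g)=t(g)=b\}$ is the stabilizer group, $\mathcal{G}_b=s^{-1}(b)$, $\mathcal{G}^b=t^{-1}(b)$. A right $\mathcal{G}$-space is a space $X$ with an anchor map $a_X\colon X\to\mathcal{G}^0$ and a continuous action $(x,g)\mapsto xg$ defined when $a_X(x)=t(g)$, such that $a_X(xg)=s(g)$, $x\,i(a_X(x))=x$, and $(xg)g'=x(gg')$ whenever defined. A map admits local sections if every point of its codomain has an open neighborhood on which a continuous section is defined. A principal $\mathcal{G}$-bundle over a Hausdorff paracompact space $M$ (the spaces $M$ considered are such) is a paracompact space $P$ with a surjective map $\pi\colon P\to M$ and a right $\mathcal{G}$-action with anchor map $\epsilon\colon P\to\mathcal{G}^0$ such that (1) $\pi$ has local sections; (2) $\pi(pg)=\pi(p)$ whenever $\epsilon(p)=t(g)$; (3) the map $\{(p,g)\in P\times\mathcal{G}^1\mid\epsilon(p)=t(g)\}\to P\times_M P$, $(p,g)\mapsto(p,pg)$, is a homeomorphism. An isomorphism of principal $\mathcal{G}$-bundles over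 $M$ is a $\mathcal{G}$-equivariant homeomorphism (commuting with anchor maps and actions) that commutes with the projections to $M$. The pullback of $\pi\colon P\to M$ along $F\colon N\to M$ is $F^*P=\{(x,p)\in N\times P\mid F(x)=\pi(p)\}\to N$, with anchor map $(x,p)\mapsto\epsilon(p)$ and action $(x,p)g=(x,pg)$; pullback makes $\mathcal{B}_{\mathcal{G}}$ a contravariant functor, and precomposition makes $[\,\cdot\,,B\mathcal{G}_b^b]$ one. Let $\rho\colon E\mathcal{G}_b^b\to B\mathcal{G}_b^b$ be the universal principal bundle of the topological group $\mathcal{G}_b^b$. Then $E\mathcal{G}:=E\mathcal{G}_b^b\times_{\mathcal{G}_b^b}\mathcal{G}^b$ is the orbit space of the anti-diagonal action $g(z,f)=(zg^{-1},gf)$ of $\mathcal{G}_b^b$ on $E\mathcal{G}_b^b\times\mathcal{G}^b$, a right $\mathcal{G}$-space with anchor $[z,f]\mapsto s(f)$ and action $[z,f]f'=[z,ff']$; the universal $\mathcal{G}$-bundle is the principal $\mathcal{G}$-bundle $\rho'\colon E\mathcal{G}\to B\mathcal{G}_b^b$, $\rho'([z,f])=\rho(z)$.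
   Formalization: For the bijection and the natural isomorphism it is additionally assumed that all pullbacks of EG to the spaces concerned are paracompact; without this they fail, e.g. for the pair groupoid on the Sorgenfrey line X with M = X. *)

theory Defs
  imports "HOL-Analysis.Analysis"
begin

section \<open>Spaces\<close>

text \<open>All spaces are compactly generated Hausdorff, and products are formed in that category,
  i.e. they are k-ifications of the usual product topology.  The fibre products and fibres
  used below are closed subsets of such spaces and the domains of local sections are open ones,
  so they are again compactly generated in the ordinary subspace topology.\<close>

definition cgh_space :: "'a topology \<Rightarrow> bool" where
  "cgh_space X \<longleftrightarrow> Hausdorff_space X \<and> k_space X"

definition kprod_topology :: "'a topology \<Rightarrow> 'b topology \<Rightarrow> ('a \<times> 'b) topology" where
  "kprod_topology X Y = kification (prod_topology X Y)"

definition paracompact_space :: "'a topology \<Rightarrow> bool" where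
  "paracompact_space X \<longleftrightarrow>
     (\<forall>\<U>. (\<forall>U\<in>\<U>. openin X U) \<and> \<Union>\<U> = topspace X \<longrightarrow>
       (\<exists>\<V>. (\<forall>V\<in>\<V>. openin X V) \<and> \<Union>\<V> = topspace X \<and>
            (\<forall>V\<in>\<V>. \<exists>U\<in>\<U>. V \<subseteq> U) \<and> locally_finite_in X \<V>))"

definition base_space :: "'a topology \<Rightarrow> bool" where
  "base_space M \<longleftrightarrow> cgh_space M \<and> paracompact_space M"

definition quotient_topology :: "'a topology \<Rightarrow> ('a \<Rightarrow> 'b) \<Rightarrow> 'b topology" where
  "quotient_topology X q =
     topology (\<lambda>U. U \<subseteq> q ` topspace X \<and> openin X {x \<in> topspace X. q x \<in> U})"

lemma istopology_quotient:
  "istopology (\<lambda>U. U \<subseteq> q ` topspace X \<and> openin X {x \<in> topspace X. q x \<in> U})"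
  unfolding istopology_def
proof (intro conjI allI impI)
  fix S T
  assume S: "S \<subseteq> q ` topspace X \<and> openin X {x \<in> topspace X. q x \<in> S}"
    and T: "T \<subseteq> q ` topspace X \<and> openin X {x \<in> topspace X. q x \<in> T}"
  show "S \<inter> T \<subseteq> q ` topspace X" using S by auto
  have "{x \<in> topspace X. q x \<in> S \<inter> T} = {x \<in> topspace X. q x \<in> S} \<inter> {x \<in> topspace X. q x \<in> T}"
    by auto
  with S T show "openin X {x \<in> topspace X. q x \<in> S \<inter> T}" by (simp add: openin_Int)
next
  fix \<K>
  assume K: "\<forall>U\<in>\<K>. U \<subseteq> q ` topspace X \<and> openin X {x \<in> topspace X. q x \<in> U}"
  show "\<Union>\<K> \<subseteq> q ` topspace X" using K by auto
  have "{x \<in> topspace X. q x \<in> \<Union>\<K>} = (\<Union>U\<in>\<K>. {x \<in> topspace X. q x \<in> U})" by auto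
  moreover have "openin X (\<Union>U\<in>\<K>. {x \<in> topspace X. q x \<in> U})" using K by auto
  ultimately show "openin X {x \<in> topspace X. q x \<in> \<Union>\<K>}" by simp
qed

lemma openin_quotient_topology:
  "openin (quotient_topology X q) U \<longleftrightarrow>
     U \<subseteq> q ` topspace X \<and> openin X {x \<in> topspace X. q x \<in> U}"
  unfolding quotient_topology_def by (simp only: topology_inverse'[OF istopology_quotient])

lemma topspace_quotient_topology: "topspace (quotient_topology X q) = q ` topspace X"
proof (rule antisym)
  show "topspace (quotient_topology X q) \<subseteq> q ` topspace X"
    by (metis openin_quotient_topology openin_topspace)
  have "{x \<in> topspace X. q x \<in> q ` topspace X} = topspace X" by auto
  then show "q ` topspace X \<subseteq> topspace (quotient_topology X q)"
    by (intro openin_subset) (simp add: openin_quotient_topology)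
qed

lemma quotient_map_quotient_topology: "quotient_map X (quotient_topology X q) q"
  unfolding quotient_map_def
  by (auto simp: openin_quotient_topology topspace_quotient_topology)

definition admits_local_sections :: "'a topology \<Rightarrow> 'b topology \<Rightarrow> ('a \<Rightarrow> 'b) \<Rightarrow> bool" where
  "admits_local_sections X Y f \<longleftrightarrow>
     (\<forall>y\<in>topspace Y. \<exists>U \<sigma>. openin Y U \<and> y \<in> U \<and>
        continuous_map (subtopology Y U) X \<sigma> \<and> (\<forall>u\<in>U. f (\<sigma> u) = u))"

section \<open>Topological groupoids\<close>

record ('o, 'g) groupoid =
  Obj :: "'o topology"
  Arr :: "'g topology"
  idt :: "'o \<Rightarrow> 'g"
  src :: "'g \<Rightarrow> 'o"
  tgt :: "'g \<Rightarrow> 'o"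
  ginv :: "'g \<Rightarrow> 'g"
  gcomp :: "'g \<Rightarrow> 'g \<Rightarrow> 'g"

text \<open>\<open>gcomp G g h\<close> is \<open>g \<circ> h\<close>, meaningful when \<open>src G g = tgt G h\<close>.\<close>

definition composable :: "('o, 'g) groupoid \<Rightarrow> ('g \<times> 'g) topology" where
  "composable G = subtopology (kprod_topology (Arr G) (Arr G)) {(g, h). src G g = tgt G h}"

definition topological_groupoid :: "('o, 'g) groupoid \<Rightarrow> bool" where
  "topological_groupoid G \<longleftrightarrow>
     cgh_space (Obj G) \<and> cgh_space (Arr G) \<and>
     continuous_map (Obj G) (Arr G) (idt G) \<and>
     continuous_map (Arr G) (Obj G) (src G) \<and>
     continuous_map (Arr G) (Obj G) (tgt G) \<and>
     continuous_map (Arr G) (Arr G) (ginv G) \<and>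
     continuous_map (composable G) (Arr G) (\<lambda>(g, h). gcomp G g h) \<and>
     open_map (Arr G) (Obj G) (src G) \<and>
     (\<forall>x\<in>topspace (Obj G). src G (idt G x) = x \<and> tgt G (idt G x) = x) \<and>
     (\<forall>g\<in>topspace (Arr G). \<forall>h\<in>topspace (Arr G). src G g = tgt G h \<longrightarrow>
        src G (gcomp G g h) = src G h \<and> tgt G (gcomp G g h) = tgt G g) \<and>
     (\<forall>g\<in>topspace (Arr G). \<forall>h\<in>topspace (Arr G). \<forall>k\<in>topspace (Arr G).
        src G g = tgt G h \<and> src G h = tgt G k \<longrightarrow>
        gcomp G (gcomp G g h) k = gcomp G g (gcomp G h k)) \<and>
     (\<forall>g\<in>topspace (Arr G).
        gcomp G g (idt G (src G g)) = g \<and> gcomp G (idt G (tgt G g)) g = g) \<and>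
     (\<forall>g\<in>topspace (Arr G).
        src G (ginv G g) = tgt G g \<and> tgt G (ginv G g) = src G g \<and>
        gcomp G g (ginv G g) = idt G (tgt G g) \<and> gcomp G (ginv G g) g = idt G (src G g))"

definition orbit_space :: "('o, 'g) groupoid \<Rightarrow> 'o set set" where
  "orbit_space G =
     topspace (Obj G) // {(src G g, tgt G g) | g. g \<in> topspace (Arr G)}"

definition transitive_groupoid :: "('o, 'g) groupoid \<Rightarrow> bool" where
  "transitive_groupoid G \<longleftrightarrow> is_singleton (orbit_space G)"

definition arrows_from :: "('o, 'g) groupoid \<Rightarrow> 'o \<Rightarrow> 'g topology" where
  "arrows_from G b = subtopology (Arr G) {g. src G g = b}"

definition arrows_into :: "('o, 'g) groupoid \<Rightarrow> 'o \<Rightarrow> 'g topology" where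
  "arrows_into G b = subtopology (Arr G) {g. tgt G g = b}"

text \<open>The stabilizer group at \<open>b\<close>, as a groupoid with the single object \<open>b\<close>.  A principal bundle
  of the topological group is a principal bundle of this groupoid, the anchor map being constant.\<close>

definition stabilizer :: "('o, 'g) groupoid \<Rightarrow> 'o \<Rightarrow> ('o, 'g) groupoid" where
  "stabilizer G b =
     G\<lparr>Obj := subtopology (Obj G) {b}, Arr := subtopology (Arr G) {g. src G g = b \<and> tgt G g = b}\<rparr>"

definition compact_stabilizers :: "('o, 'g) groupoid \<Rightarrow> bool" where
  "compact_stabilizers G \<longleftrightarrow>
     (\<forall>x\<in>topspace (Obj G). compact_space (Arr (stabilizer G x)))"

section \<open>Right actions and principal bundles\<close>

definition right_space ::
  "('o, 'g) groupoid \<Rightarrow> 'x topology \<Rightarrow> ('x \<Rightarrow> 'o) \<Rightarrow> ('x \<Rightarrow> 'g \<Rightarrow> 'x) \<Rightarrow> bool" where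
  "right_space G X a act \<longleftrightarrow>
     cgh_space X \<and> continuous_map X (Obj G) a \<and>
     continuous_map (subtopology (kprod_topology X (Arr G)) {(x, g). a x = tgt G g}) X
       (\<lambda>(x, g). act x g) \<and>
     (\<forall>x\<in>topspace X. \<forall>g\<in>topspace (Arr G). a x = tgt G g \<longrightarrow> a (act x g) = src G g) \<and>
     (\<forall>x\<in>topspace X. act x (idt G (a x)) = x) \<and>
     (\<forall>x\<in>topspace X. \<forall>g\<in>topspace (Arr G). \<forall>h\<in>topspace (Arr G).
        a x = tgt G g \<and> src G g = tgt G h \<longrightarrow> act (act x g) h = act x (gcomp G g h))"

record ('p, 'm, 'o, 'g) gbundle =
  total_space :: "'p topology"
  proj :: "'p \<Rightarrow> 'm"
  anchor :: "'p \<Rightarrow> 'o"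
  act :: "'p \<Rightarrow> 'g \<Rightarrow> 'p"

definition principal_bundle ::
  "('o, 'g) groupoid \<Rightarrow> 'm topology \<Rightarrow> ('p, 'm, 'o, 'g) gbundle \<Rightarrow> bool" where
  "principal_bundle G M P \<longleftrightarrow>
     base_space M \<and> paracompact_space (total_space P) \<and>
     continuous_map (total_space P) M (proj P) \<and> proj P ` topspace (total_space P) = topspace M \<and>
     right_space G (total_space P) (anchor P) (act P) \<and>
     admits_local_sections (total_space P) M (proj P) \<and>
     (\<forall>p\<in>topspace (total_space P). \<forall>g\<in>topspace (Arr G). anchor P p = tgt G g \<longrightarrow>
        proj P (act P p g) = proj P p) \<and>
     homeomorphic_map
       (subtopology (kprod_topology (total_space P) (Arr G)) {(p, g). anchor P p = tgt G g})
       (subtopology (kprod_topology (total_space P) (total_space P)) {(p, q). proj P p = proj P q})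
       (\<lambda>(p, g). (p, act P p g))"

definition bundle_isomorphic ::
  "('o, 'g) groupoid \<Rightarrow> ('p, 'm, 'o, 'g) gbundle \<Rightarrow> ('q, 'm, 'o, 'g) gbundle \<Rightarrow> bool" where
  "bundle_isomorphic G P Q \<longleftrightarrow>
     (\<exists>\<phi>. homeomorphic_map (total_space P) (total_space Q) \<phi> \<and>
        (\<forall>p\<in>topspace (total_space P). proj Q (\<phi> p) = proj P p \<and> anchor Q (\<phi> p) = anchor P p) \<and>
        (\<forall>p\<in>topspace (total_space P). \<forall>g\<in>topspace (Arr G). anchor P p = tgt G g \<longrightarrow>
           \<phi> (act P p g) = act Q (\<phi> p) g))"

definition pullback_bundle ::
  "'n topology \<Rightarrow> ('n \<Rightarrow> 'm) \<Rightarrow> ('p, 'm, 'o, 'g) gbundle \<Rightarrow> ('n \<times> 'p, 'n, 'o, 'g) gbundle" where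
  "pullback_bundle N F P =
     \<lparr>total_space = subtopology (kprod_topology N (total_space P)) {(x, p). F x = proj P p},
      proj = fst,
      anchor = (\<lambda>(x, p). anchor P p),
      act = (\<lambda>(x, p) g. (x, act P p g))\<rparr>"

lemma topspace_kprod_topology [simp]:
  "topspace (kprod_topology X Y) = topspace X \<times> topspace Y"
  by (simp add: kprod_topology_def)

lemma continuous_map_kprod_map:
  assumes "continuous_map X X' f" and "continuous_map Y Y' g"
  shows "continuous_map (kprod_topology X Y) (kprod_topology X' Y') (\<lambda>(x, y). (f x, g y))"
proof -
  have "continuous_map (prod_topology X Y) (prod_topology X' Y') (\<lambda>(x, y). (f x, g y))"
    using assms by (simp add: continuous_map_prod_top)
  then show ?thesis
    unfolding kprod_topology_def
    by (simp add: continuous_map_from_kification continuous_map_into_kification)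
qed

lemma homeomorphic_maps_kprod:
  assumes "homeomorphic_maps X X' f f'" and "homeomorphic_maps Y Y' g g'"
  shows "homeomorphic_maps (kprod_topology X Y) (kprod_topology X' Y')
           (\<lambda>(x, y). (f x, g y)) (\<lambda>(x, y). (f' x, g' y))"
  using assms unfolding homeomorphic_maps_def
  by (auto intro: continuous_map_kprod_map)

lemma homeomorphic_paracompact_space:
  assumes XY: "homeomorphic_maps X Y f g" and X: "paracompact_space X"
  shows "paracompact_space Y"
  unfolding paracompact_space_def
proof (intro allI impI)
  fix \<U> assume U: "(\<forall>U\<in>\<U>. openin Y U) \<and> \<Union>\<U> = topspace Y"
  have hf: "homeomorphic_map X Y f" and hg: "homeomorphic_map Y X g"
    using XY homeomorphic_maps_map by blast+
  have gf: "g (f x) = x" "f x \<in> topspace Y" if "x \<in> topspace X" for x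
    using XY that by (auto simp: homeomorphic_maps_def continuous_map_def)
  have fg: "f (g y) = y" "g y \<in> topspace X" if "y \<in> topspace Y" for y
    using XY that by (auto simp: homeomorphic_maps_def continuous_map_def)
  have opf: "openin Y (f ` S)" if "openin X S" for S
    using hf that by (meson homeomorphic_imp_open_map open_map_def)
  have opg: "openin X (g ` S)" if "openin Y S" for S
    using hg that by (meson homeomorphic_imp_open_map open_map_def)
  have gY: "g ` topspace Y = topspace X"
    using homeomorphic_imp_surjective_map[OF hg] .
  have fX: "f ` topspace X = topspace Y"
    using homeomorphic_imp_surjective_map[OF hf] .
  have 1: "\<forall>U\<in>(`) g ` \<U>. openin X U" using U opg by auto
  have "\<Union>((`) g ` \<U>) = g ` \<Union>\<U>" by auto
  also have "\<dots> = topspace X" using U gY by simp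
  finally have 2: "\<Union>((`) g ` \<U>) = topspace X" .
  from X[unfolded paracompact_space_def, THEN spec, THEN mp, OF conjI[OF 1 2]]
  obtain \<V> where V: "\<forall>V\<in>\<V>. openin X V" "\<Union>\<V> = topspace X"
     "\<forall>V\<in>\<V>. \<exists>U\<in>(`) g ` \<U>. V \<subseteq> U" "locally_finite_in X \<V>"
    by (elim exE conjE)
  let ?W = "(`) f ` \<V>"
  have "\<forall>V\<in>?W. openin Y V" using V opf by auto
  moreover have "\<Union>?W = topspace Y"
  proof -
    have "\<Union>?W = f ` \<Union>\<V>" by auto
    also have "\<dots> = topspace Y" unfolding V(2) by (rule fX)
    finally show ?thesis .
  qed
  moreover have "\<forall>V\<in>?W. \<exists>U\<in>\<U>. V \<subseteq> U"
  proof
    fix W assume "W \<in> ?W"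
    then obtain V0 where V0: "V0 \<in> \<V>" "W = f ` V0" by auto
    then obtain U0 where U0: "U0 \<in> \<U>" "V0 \<subseteq> g ` U0" using V(3) by auto
    have "U0 \<subseteq> topspace Y" using U U0(1) openin_subset by metis
    have "f ` g ` U0 \<subseteq> U0" using fg(1) \<open>U0 \<subseteq> topspace Y\<close> by auto
    then have "W \<subseteq> U0" using V0(2) image_mono[OF U0(2), of f] by simp
    then show "\<exists>U\<in>\<U>. W \<subseteq> U" using U0 by blast
  qed
  moreover have "locally_finite_in Y ?W"
    unfolding locally_finite_in_def
  proof (intro conjI ballI)
    show "\<Union>?W \<subseteq> topspace Y" using calculation(2) by simp
    fix y assume y: "y \<in> topspace Y"
    obtain O1 where O1: "openin X O1" "g y \<in> O1" "finite {U \<in> \<V>. U \<inter> O1 \<noteq> {}}"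
      using V(4) fg(2)[OF y] unfolding locally_finite_in_def by meson
    have sub: "O1 \<subseteq> topspace X" using O1 openin_subset by blast
    have "{U \<in> ?W. U \<inter> f ` O1 \<noteq> {}} \<subseteq> (`) f ` {U \<in> \<V>. U \<inter> O1 \<noteq> {}}"
    proof
      fix W assume "W \<in> {U \<in> ?W. U \<inter> f ` O1 \<noteq> {}}"
      then obtain V0 where V0: "V0 \<in> \<V>" "W = f ` V0" "f ` V0 \<inter> f ` O1 \<noteq> {}" by auto
      then obtain a c where ac: "a \<in> V0" "c \<in> O1" "f a = f c" by auto
      have "a \<in> topspace X" using ac V0 V(2) by auto
      then have "a = c" using ac sub gf(1) by (metis subsetD)
      then show "W \<in> (`) f ` {U \<in> \<V>. U \<inter> O1 \<noteq> {}}" using V0 ac by auto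
    qed
    then have "finite {U \<in> ?W. U \<inter> f ` O1 \<noteq> {}}" by (rule finite_subset) (rule finite_imageI[OF O1(3)])
    moreover have "y \<in> f ` O1" using imageI[OF O1(2), of f] fg(1)[OF y] by simp
    ultimately show "\<exists>V. openin Y V \<and> y \<in> V \<and> finite {U \<in> ?W. U \<inter> V \<noteq> {}}"
      using opf[OF O1(1)] by (intro exI[of _ "f ` O1"] conjI)
  qed
  ultimately show "\<exists>\<V>. (\<forall>V\<in>\<V>. openin Y V) \<and> \<Union>\<V> = topspace Y \<and>
            (\<forall>V\<in>\<V>. \<exists>U\<in>\<U>. V \<subseteq> U) \<and> locally_finite_in Y \<V>" by blast
qed

definition transport_bundle ::
  "'q topology \<Rightarrow> ('p \<Rightarrow> 'q) \<Rightarrow> ('q \<Rightarrow> 'p) \<Rightarrow> ('p, 'm, 'o, 'g) gbundle \<Rightarrow> ('q, 'm, 'o, 'g) gbundle"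
  where
  "transport_bundle Y h k P =
     \<lparr>total_space = Y, proj = (\<lambda>q. proj P (k q)), anchor = (\<lambda>q. anchor P (k q)),
      act = (\<lambda>q g. h (act P (k q) g))\<rparr>"

lemma principal_bundle_transport:
  assumes hk: "homeomorphic_maps (total_space P) Y h k" and P: "principal_bundle G M P"
  shows "principal_bundle G M (transport_bundle Y h k P)"
    and "bundle_isomorphic G P (transport_bundle Y h k P)"
proof -
  let ?X = "total_space P" and ?A = "Arr G"
  have conts: "continuous_map ?X Y h" "continuous_map Y ?X k"
    using hk by (auto simp: homeomorphic_maps_def)
  have kh: "k (h x) = x" "h x \<in> topspace Y" if "x \<in> topspace ?X" for x
    using hk that by (auto simp: homeomorphic_maps_def continuous_map_def)
  have hk': "h (k y) = y" "k y \<in> topspace ?X" if "y \<in> topspace Y" for y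
    using hk that by (auto simp: homeomorphic_maps_def continuous_map_def)
  have base: "base_space M" and par: "paracompact_space ?X"
    and pc: "continuous_map ?X M (proj P)" and ps: "proj P ` topspace ?X = topspace M"
    and rs: "right_space G ?X (anchor P) (act P)"
    and ls: "admits_local_sections ?X M (proj P)"
    and inv: "\<And>p g. p \<in> topspace ?X \<Longrightarrow> g \<in> topspace ?A \<Longrightarrow> anchor P p = tgt G g \<Longrightarrow>
        proj P (act P p g) = proj P p"
    and hm: "homeomorphic_map
       (subtopology (kprod_topology ?X ?A) {(p, g). anchor P p = tgt G g})
       (subtopology (kprod_topology ?X ?X) {(p, q). proj P p = proj P q})
       (\<lambda>(p, g). (p, act P p g))"
    using P unfolding principal_bundle_def by auto
  have cgX: "cgh_space ?X" and ac: "continuous_map ?X (Obj G) (anchor P)"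
    and actc: "continuous_map (subtopology (kprod_topology ?X ?A) {(x, g). anchor P x = tgt G g}) ?X
       (\<lambda>(x, g). act P x g)"
    and as: "\<And>x g. x \<in> topspace ?X \<Longrightarrow> g \<in> topspace ?A \<Longrightarrow> anchor P x = tgt G g \<Longrightarrow>
       anchor P (act P x g) = src G g"
    and ai: "\<And>x. x \<in> topspace ?X \<Longrightarrow> act P x (idt G (anchor P x)) = x"
    and aa: "\<And>x g g'. x \<in> topspace ?X \<Longrightarrow> g \<in> topspace ?A \<Longrightarrow> g' \<in> topspace ?A \<Longrightarrow>
       anchor P x = tgt G g \<Longrightarrow> src G g = tgt G g' \<Longrightarrow>
       act P (act P x g) g' = act P x (gcomp G g g')"
    using rs unfolding right_space_def by auto
  have actX: "act P x g \<in> topspace ?X"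
    if "x \<in> topspace ?X" "g \<in> topspace ?A" "anchor P x = tgt G g" for x g
  proof -
    have "(x, g) \<in> topspace (subtopology (kprod_topology ?X ?A) {(x, g). anchor P x = tgt G g})"
      using that by simp
    then have "(\<lambda>(x, g). act P x g) (x, g) \<in> topspace ?X"
      using continuous_map_image_subset_topspace[OF actc] by blast
    then show ?thesis by simp
  qed
  have hs: "?X homeomorphic_space Y" using hk homeomorphic_maps_imp_homeomorphic_space by blast
  have cgY: "cgh_space Y"
    using cgX hs homeomorphic_k_space homeomorphic_Hausdorff_space unfolding cgh_space_def by blast
  have idA: "homeomorphic_maps ?A ?A (\<lambda>x. x) (\<lambda>x. x)" by (simp add: homeomorphic_maps_def)
  have e1: "homeomorphic_map
      (subtopology (kprod_topology Y ?A) {(q, g). anchor P (k q) = tgt G g})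
      (subtopology (kprod_topology ?X ?A) {(p, g). anchor P p = tgt G g}) (\<lambda>(q, g). (k q, g))"
  proof (rule homeomorphic_map_subtopologies_alt)
    show "homeomorphic_map (kprod_topology Y ?A) (kprod_topology ?X ?A) (\<lambda>(q, g). (k q, g))"
      using homeomorphic_maps_kprod[OF hk idA] homeomorphic_maps_map by blast
  qed auto
  have e2: "homeomorphic_map
      (subtopology (kprod_topology ?X ?X) {(p, q). proj P p = proj P q})
      (subtopology (kprod_topology Y Y) {(p, q). proj P (k p) = proj P (k q)})
      (\<lambda>(p, q). (h p, h q))"
  proof (rule homeomorphic_map_subtopologies_alt)
    show "homeomorphic_map (kprod_topology ?X ?X) (kprod_topology Y Y) (\<lambda>(p, q). (h p, h q))"
      using homeomorphic_maps_kprod[OF hk hk] homeomorphic_maps_map by blast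
  qed (auto simp: kh)
  have hmY: "homeomorphic_map
      (subtopology (kprod_topology Y ?A) {(q, g). anchor P (k q) = tgt G g})
      (subtopology (kprod_topology Y Y) {(p, q). proj P (k p) = proj P (k q)})
      (\<lambda>(q, g). (q, h (act P (k q) g)))"
    by (rule homeomorphic_map_eq[OF homeomorphic_map_compose[OF homeomorphic_map_compose[OF e1 hm] e2]])
       (auto simp: hk')
  have actcY: "continuous_map (subtopology (kprod_topology Y ?A) {(q, g). anchor P (k q) = tgt G g}) Y
       (\<lambda>(q, g). h (act P (k q) g))"
  proof -
    have "continuous_map (subtopology (kprod_topology Y ?A) {(q, g). anchor P (k q) = tgt G g}) Y
       (h \<circ> ((\<lambda>(x, g). act P x g) \<circ> (\<lambda>(q, g). (k q, g))))"
      using continuous_map_compose[OF continuous_map_compose[OF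
            homeomorphic_imp_continuous_map[OF e1] actc] conts(1)] .
    moreover have "h \<circ> ((\<lambda>(x, g). act P x g) \<circ> (\<lambda>(q, g). (k q, g))) = (\<lambda>(q, g). h (act P (k q) g))"
      by auto
    ultimately show ?thesis by simp
  qed
  have rsY: "right_space G Y (\<lambda>q. anchor P (k q)) (\<lambda>q g. h (act P (k q) g))"
    unfolding right_space_def
  proof (intro conjI)
    show "continuous_map Y (Obj G) (\<lambda>q. anchor P (k q))"
      using continuous_map_compose[OF conts(2) ac] by (simp add: o_def)
  qed (use cgY actcY in \<open>auto simp: kh hk' actX as ai aa\<close>)
  have lsY: "admits_local_sections Y M (\<lambda>q. proj P (k q))"
    unfolding admits_local_sections_def
  proof
    fix y assume "y \<in> topspace M"
    then obtain U \<sigma> where U: "openin M U" "y \<in> U" and s: "continuous_map (subtopology M U) ?X \<sigma>"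
      and "\<forall>u\<in>U. proj P (\<sigma> u) = u"
      using ls unfolding admits_local_sections_def by meson
    moreover have "\<sigma> u \<in> topspace ?X" if "u \<in> U" for u
      using continuous_map_image_subset_topspace[OF s] openin_subset[OF U(1)] that by auto
    ultimately have "\<forall>u\<in>U. proj P (k ((h \<circ> \<sigma>) u)) = u" by (simp add: kh)
    then show "\<exists>U \<sigma>. openin M U \<and> y \<in> U \<and> continuous_map (subtopology M U) Y \<sigma> \<and>
        (\<forall>u\<in>U. proj P (k (\<sigma> u)) = u)"
      using U continuous_map_compose[OF s conts(1)] by blast
  qed
  have pcY: "continuous_map Y M (\<lambda>q. proj P (k q))"
    using continuous_map_compose[OF conts(2) pc] by (simp add: o_def)
  have psY: "(\<lambda>q. proj P (k q)) ` topspace Y = topspace M"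
  proof -
    have "k ` topspace Y = topspace ?X"
      using hk homeomorphic_imp_surjective_map[of Y ?X k] by (simp add: homeomorphic_maps_map)
    then show ?thesis using ps image_image[of "proj P" k "topspace Y"] by simp
  qed
  show "principal_bundle G M (transport_bundle Y h k P)"
    unfolding principal_bundle_def transport_bundle_def
    using base homeomorphic_paracompact_space[OF hk par] pcY psY rsY lsY hmY
    by (auto simp: kh hk' actX inv)
  show "bundle_isomorphic G P (transport_bundle Y h k P)"
    unfolding bundle_isomorphic_def transport_bundle_def
    using hk by (intro exI[of _ h]) (auto simp: kh homeomorphic_maps_map)
qed

lemma principal_bundle_representative:
  fixes P :: "('p, 'm, 'o, 'g) gbundle"
  assumes P: "principal_bundle G M P"
  shows "\<exists>Q :: ('m \<times> 'g, 'm, 'o, 'g) gbundle. principal_bundle G M Q \<and> bundle_isomorphic G P Q"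
proof -
  let ?X = "total_space P"
  define \<beta> where "\<beta> m = (SOME p. p \<in> topspace ?X \<and> proj P p = m)" for m
  define d where "d p = (SOME g. g \<in> topspace (Arr G) \<and> act P (\<beta> (proj P p)) g = p)" for p
  define h where "h p = (proj P p, d p)" for p
  have hm: "homeomorphic_map
       (subtopology (kprod_topology ?X (Arr G)) {(p, g). anchor P p = tgt G g})
       (subtopology (kprod_topology ?X ?X) {(p, q). proj P p = proj P q})
       (\<lambda>(p, g). (p, act P p g))"
    using P unfolding principal_bundle_def by auto
  have d: "act P (\<beta> (proj P p)) (d p) = p" if p: "p \<in> topspace ?X" for p
  proof -
    have b: "\<beta> (proj P p) \<in> topspace ?X \<and> proj P (\<beta> (proj P p)) = proj P p"
      unfolding \<beta>_def by (rule someI[of _ p]) (simp add: p)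
    then have "(\<beta> (proj P p), p) \<in>
        topspace (subtopology (kprod_topology ?X ?X) {(p, q). proj P p = proj P q})"
      using p by simp
    then have "(\<beta> (proj P p), p) \<in> (\<lambda>(p, g). (p, act P p g)) `
        topspace (subtopology (kprod_topology ?X (Arr G)) {(p, g). anchor P p = tgt G g})"
      using homeomorphic_imp_surjective_map[OF hm] by simp
    then obtain g where "g \<in> topspace (Arr G)" "act P (\<beta> (proj P p)) g = p"
      by (auto simp del: topspace_subtopology simp add: topspace_subtopology[of "kprod_topology _ _"])
    then show ?thesis unfolding d_def by (metis (mono_tags, lifting) someI_ex)
  qed
  have "inj_on h (topspace ?X)"
    by (rule inj_onI) (metis d h_def prod.inject)
  then have "homeomorphic_map ?X (quotient_topology ?X h) h"
    by (simp add: homeomorphic_map_def quotient_map_quotient_topology)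
  then obtain k where "homeomorphic_maps ?X (quotient_topology ?X h) h k"
    using homeomorphic_map_maps by blast
  from principal_bundle_transport[OF this P] show ?thesis by blast
qed

section \<open>The functors\<close>

text \<open>The set of all isomorphism classes of principal bundles over \<open>M\<close> is formed with total spaces
  carried by the type \<open>'m \<times> 'g\<close>.  This loses nothing: every fibre is in bijection with the set of
  arrows into some object, and every principal bundle, on whatever type, is isomorphic to one
  on \<open>'m \<times> 'g\<close> (lemma \<open>principal_bundle_representative\<close> above).\<close>

definition iso_classes ::
  "('o, 'g) groupoid \<Rightarrow> 'm topology \<Rightarrow> ('m \<times> 'g, 'm, 'o, 'g) gbundle set set" where
  "iso_classes G M =
     {P. principal_bundle G M P} //
     {(P, Q). principal_bundle G M P \<and> principal_bundle G M Q \<and> bundle_isomorphic G P Q}"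

definition pullback_class ::
  "('o, 'g) groupoid \<Rightarrow> 'n topology \<Rightarrow> ('n \<Rightarrow> 'm) \<Rightarrow>
     ('m \<times> 'g, 'm, 'o, 'g) gbundle set \<Rightarrow> ('n \<times> 'g, 'n, 'o, 'g) gbundle set" where
  "pullback_class G N F c =
     {Q. principal_bundle G N Q \<and> (\<exists>P\<in>c. bundle_isomorphic G Q (pullback_bundle N F P))}"

text \<open>The product of a compactly generated Hausdorff space with the unit interval is compactly
  generated, so the library's notion of homotopy is the one of the category.\<close>

definition homotopy_classes :: "'m topology \<Rightarrow> 'b topology \<Rightarrow> ('m \<Rightarrow> 'b) set set" where
  "homotopy_classes M B =
     {f. continuous_map M B f} // {(f, h). homotopic_with (\<lambda>_. True) M B f h}"

definition precomp_class ::
  "'n topology \<Rightarrow> 'b topology \<Rightarrow> ('n \<Rightarrow> 'm) \<Rightarrow> ('m \<Rightarrow> 'b) set \<Rightarrow> ('n \<Rightarrow> 'b) set" where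
  "precomp_class N B F c = {h. \<exists>f\<in>c. homotopic_with (\<lambda>_. True) N B (f \<circ> F) h}"

text \<open>The map \<open>[f] \<mapsto> [f\<^sup>* E]\<close>.\<close>

definition classifying_class ::
  "('o, 'g) groupoid \<Rightarrow> 'm topology \<Rightarrow> ('e, 'b, 'o, 'g) gbundle \<Rightarrow>
     ('m \<Rightarrow> 'b) set \<Rightarrow> ('m \<times> 'g, 'm, 'o, 'g) gbundle set" where
  "classifying_class G M E c =
     {Q. principal_bundle G M Q \<and> (\<exists>f\<in>c. bundle_isomorphic G Q (pullback_bundle M f E))}"

section \<open>Universal bundles\<close>

text \<open>A principal bundle \<open>E \<rightarrow> B\<close> is universal if every principal bundle over every paracompact
  base is isomorphic to a pullback of \<open>E\<close> along a map that is unique up to homotopy, and homotopic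
  maps induce isomorphic pullbacks.  The bases range over spaces carried by the type \<open>'m\<close>; types
  cannot be quantified within a formula.\<close>

definition universal_bundle ::
  "'m itself \<Rightarrow> ('o, 'g) groupoid \<Rightarrow> 'b topology \<Rightarrow> ('e, 'b, 'o, 'g) gbundle \<Rightarrow> bool" where
  "universal_bundle _ K B E \<longleftrightarrow>
     principal_bundle K B E \<and>
     (\<forall>M :: 'm topology. base_space M \<longrightarrow>
        (\<forall>Q :: ('m \<times> 'g, 'm, 'o, 'g) gbundle. principal_bundle K M Q \<longrightarrow>
           (\<exists>f. continuous_map M B f \<and> bundle_isomorphic K Q (pullback_bundle M f E))) \<and>
        (\<forall>f h. continuous_map M B f \<longrightarrow> continuous_map M B h \<longrightarrow>
           (bundle_isomorphic K (pullback_bundle M f E) (pullback_bundle M h E) \<longleftrightarrow>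
            homotopic_with (\<lambda>_. True) M B f h)))"

definition antidiagonal_orbit ::
  "('o, 'g) groupoid \<Rightarrow> 'o \<Rightarrow> ('e, 'b, 'o, 'g) gbundle \<Rightarrow> 'e \<times> 'g \<Rightarrow> ('e \<times> 'g) set" where
  "antidiagonal_orbit G b E =
     (\<lambda>(z, f). {(act E z (ginv G k), gcomp G k f) | k. k \<in> topspace (Arr (stabilizer G b))})"

text \<open>The bundle \<open>\<rho>' : E\<G> \<rightarrow> B\<close> obtained from a principal bundle \<open>\<rho> : E \<rightarrow> B\<close> of the stabilizer at
  \<open>b\<close>.  Points of \<open>E\<G>\<close> are orbits; \<open>\<rho> z\<close> and \<open>src G f\<close> are constant on each orbit.\<close>

definition associated_bundle ::
  "('o, 'g) groupoid \<Rightarrow> 'o \<Rightarrow> ('e, 'b, 'o, 'g) gbundle \<Rightarrow> (('e \<times> 'g) set, 'b, 'o, 'g) gbundle"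
  where
  "associated_bundle G b E =
     \<lparr>total_space = quotient_topology (kprod_topology (total_space E) (arrows_into G b))
                (antidiagonal_orbit G b E),
      proj = (\<lambda>c. the_elem ((\<lambda>(z, f). proj E z) ` c)),
      anchor = (\<lambda>c. the_elem ((\<lambda>(z, f). src G f) ` c)),
      act = (\<lambda>c g. (\<lambda>(z, f). (z, gcomp G f g)) ` c)\<rparr>"

text \<open>Pullbacks of a bundle with paracompact total space need not have paracompact total space: for
  the pair groupoid on the Sorgenfrey line \<open>X\<close> the bundle \<open>E\<G>\<close> is \<open>X\<close> over a point and its pullback
  to \<open>X\<close> is \<open>X \<times> X\<close>.  So this condition is needed for pullback to be a map into isomorphism classes
  of principal bundles.\<close>

definition paracompact_pullbacks ::
  "'m topology \<Rightarrow> 'b topology \<Rightarrow> ('e, 'b, 'o, 'g) gbundle \<Rightarrow> bool" where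
  "paracompact_pullbacks M B E \<longleftrightarrow>
     (\<forall>f. continuous_map M B f \<longrightarrow> paracompact_space (total_space (pullback_bundle M f E)))"

end

theory Submission
  imports Defs
begin

text \<open>Assigning to a principal \<open>\<G>\<close>-bundle \<open>P\<close> the subspace \<open>P\<^sub>b\<close> of points anchored at \<open>b\<close> gives a
  principal bundle of the stabilizer at \<open>b\<close>: local sections of \<open>P\<close> are moved into \<open>P\<^sub>b\<close> by local sections
  of the target map on \<open>\<G>\<^sub>b\<close>.  An isomorphism \<open>P\<^sub>b \<cong> Q\<^sub>b\<close> extends uniquely to \<open>P \<cong> Q\<close> by equivariance,
  restriction commutes with pullback, and \<open>z \<mapsto> [z, id\<^sub>b]\<close> identifies \<open>E\<close> with \<open>(E\<G>)\<^sub>b\<close>.  Hence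
  \<open>P \<cong> f\<^sup>* E\<G>\<close> if and only if \<open>P\<^sub>b \<cong> f\<^sup>* E\<close>, and the classification of principal bundles of the stabilizer
  carries over.\<close>

section \<open>Compactly generated spaces\<close>

text \<open>The obstacle is paracompactness: the associated bundle and its pullbacks are not known
  to inherit it, so they cannot be treated as principal bundles. All comparisons are therefore made
  for prebundles, which are stable under pullback, under restriction to the points anchored at b,
  and under passing from E to its associated bundle. Paracompactness returns at two places. The
  subspace \<open>P_b\<close> is closed in P because \<open>Obj G\<close> is Hausdorff, hence it is
  paracompact and the universal property of E applies to it; and a pullback of the associated bundle
  represents an isomorphism class only under \<open>paracompact_pullbacks\<close>. Two devices spare
  explicit inverses: a continuous division map is as good as a homeomorphic shear map, and a
  continuous equivariant map over the base is automatically an isomorphism. The associated bundle is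
  a quotient, with few properties for free; its Hausdorff property, its action and its division map
  are all obtained from local sections of E.\<close>

lemma continuous_map_into_topspace:
  "continuous_map X Y f \<Longrightarrow> x \<in> topspace X \<Longrightarrow> f x \<in> topspace Y"
  by (auto simp: continuous_map_def)

text \<open>A k-ification has more open sets than the space it comes from; continuity into it
  reduces to continuity into that space when the domain is a k-space. This is the source of the
  \<open>k_space\<close> conditions below.\<close>

lemma continuous_map_kprod_Pair:
  assumes "k_space Z" "continuous_map Z X f" "continuous_map Z Y g"
  shows "continuous_map Z (kprod_topology X Y) (\<lambda>z. (f z, g z))"
  using assms by (simp add: kprod_topology_def continuous_map_into_kification continuous_map_pairedI)

lemma continuous_map_kprod_fst: "continuous_map (kprod_topology X Y) X fst"
  by (simp add: kprod_topology_def continuous_map_from_kification continuous_map_fst)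

lemma continuous_map_kprod_snd: "continuous_map (kprod_topology X Y) Y snd"
  by (simp add: kprod_topology_def continuous_map_from_kification continuous_map_snd)

lemma Hausdorff_space_kification:
  assumes "Hausdorff_space X" shows "Hausdorff_space (kification X)"
  unfolding Hausdorff_space_def
proof (intro allI impI, elim conjE)
  fix x y assume "x \<in> topspace (kification X)" "y \<in> topspace (kification X)" "x \<noteq> y"
  then obtain U V where "openin X U" "openin X V" "x \<in> U" "y \<in> V" "disjnt U V"
    using assms unfolding Hausdorff_space_def topspace_kification by metis
  then show "\<exists>U V. openin (kification X) U \<and> openin (kification X) V \<and> x \<in> U \<and> y \<in> V \<and> disjnt U V"
    using openin_kification_finer by metis
qed

lemma cgh_space_kprod:
  assumes "cgh_space X" "cgh_space Y" shows "cgh_space (kprod_topology X Y)"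
  using assms unfolding cgh_space_def kprod_topology_def
  by (simp add: Hausdorff_space_kification Hausdorff_space_prod_topology)

text \<open>Equalizers of maps into a Hausdorff space are closed, and closed subspaces of k-spaces
  are k-spaces. The set S has to match the equalizer only on \<open>topspace X\<close>, so
  comprehensions such as \<open>{p. anchor P p = b}\<close> fit directly.\<close>

lemma cgh_space_equalizer:
  assumes X: "cgh_space X" and Y: "Hausdorff_space Y"
    and f: "continuous_map X Y f" and g: "continuous_map X Y g"
    and S: "\<And>x. x \<in> topspace X \<Longrightarrow> x \<in> S \<longleftrightarrow> f x = g x"
  shows "cgh_space (subtopology X S)"
proof -
  have "closedin X {x \<in> topspace X. f x = g x}"
    using f g Y by (simp add: closedin_continuous_maps_eq)
  moreover have "topspace X \<inter> S = {x \<in> topspace X. f x = g x}" using S by auto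
  ultimately have "closedin X (topspace X \<inter> S)" by simp
  then show ?thesis
    using X k_space_closed_subtopology[of X "topspace X \<inter> S"] subtopology_restrict[of X S]
    unfolding cgh_space_def by (auto intro: Hausdorff_space_subtopology)
qed

lemma continuous_map_kprod_fst_sub:
  "continuous_map (subtopology (kprod_topology X Y) S) X fst"
  using continuous_map_kprod_fst continuous_map_from_subtopology by blast

lemma continuous_map_kprod_snd_sub:
  "continuous_map (subtopology (kprod_topology X Y) S) Y snd"
  using continuous_map_kprod_snd continuous_map_from_subtopology by blast

lemma cgh_space_fibre_product:
  assumes "cgh_space X" "cgh_space Y" "Hausdorff_space M" "continuous_map X M f" "continuous_map Y M g"
  shows "cgh_space (subtopology (kprod_topology X Y) {(x, y). f x = g y})"
  by (rule cgh_space_equalizer[OF cgh_space_kprod _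
        continuous_map_compose[OF continuous_map_kprod_fst assms(4)]
        continuous_map_compose[OF continuous_map_kprod_snd assms(5)]])
     (use assms in auto)

lemma cgh_space_open_subtopology:
  assumes "cgh_space X" "openin X U" shows "cgh_space (subtopology X U)"
  using assms k_space_open_subtopology unfolding cgh_space_def
  by (auto intro: Hausdorff_space_subtopology)

lemma k_space_cgh: "cgh_space X \<Longrightarrow> k_space X"
  by (simp add: cgh_space_def)

lemma continuous_map_locally:
  assumes "\<And>x. x \<in> topspace X \<Longrightarrow> \<exists>U. openin X U \<and> x \<in> U \<and> continuous_map (subtopology X U) Y f"
  shows "continuous_map X Y f"
proof -
  obtain U where U: "\<And>x. x \<in> topspace X \<Longrightarrow>
      openin X (U x) \<and> x \<in> U x \<and> continuous_map (subtopology X (U x)) Y f"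
    using assms by metis
  show ?thesis
    by (rule pasting_lemma[of "topspace X" X U Y "\<lambda>_. f" f]) (use U in auto)
qed

text \<open>A cover of C is extended to X by the complement of C, refined there, and the refinement
  is cut down to C.\<close>

lemma paracompact_space_closed_subtopology:
  assumes X: "paracompact_space X" and C: "closedin X C"
  shows "paracompact_space (subtopology X C)"
  unfolding paracompact_space_def
proof (intro allI impI, elim conjE)
  fix \<U> assume U: "\<forall>U\<in>\<U>. openin (subtopology X C) U" and cov: "\<Union>\<U> = topspace (subtopology X C)"
  have CX: "C \<subseteq> topspace X" using C closedin_subset by blast
  define \<W> where "\<W> = insert (topspace X - C) {W. openin X W \<and> W \<inter> C \<in> \<U>}"
  have 1: "\<forall>W\<in>\<W>. openin X W" using C by (auto simp: \<W>_def)
  have 2: "\<Union>\<W> = topspace X"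
  proof (rule antisym)
    show "\<Union>\<W> \<subseteq> topspace X" using 1 openin_subset by blast
    show "topspace X \<subseteq> \<Union>\<W>"
    proof
      fix x assume x: "x \<in> topspace X"
      show "x \<in> \<Union>\<W>"
      proof (cases "x \<in> C")
        case True
        with x cov obtain U where "U \<in> \<U>" "x \<in> U" by auto
        with U obtain W where "openin X W" "U = W \<inter> C" unfolding openin_subtopology by metis
        with \<open>U \<in> \<U>\<close> \<open>x \<in> U\<close> show ?thesis unfolding \<W>_def by blast
      qed (use x in \<open>auto simp: \<W>_def\<close>)
    qed
  qed
  from X[unfolded paracompact_space_def, THEN spec, THEN mp, OF conjI[OF 1 2]]
  obtain \<V> where V: "\<forall>V\<in>\<V>. openin X V" "\<Union>\<V> = topspace X"
     "\<forall>V\<in>\<V>. \<exists>W\<in>\<W>. V \<subseteq> W" "locally_finite_in X \<V>"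
    by (elim exE conjE)
  \<comment> \<open>A member that meets C cannot lie in the complement of C, so the set W containing
    it has its trace in the given cover.\<close>
  define \<V>' where "\<V>' = (\<lambda>V. V \<inter> C) ` {V \<in> \<V>. V \<inter> C \<noteq> {}}"
  have "\<forall>V\<in>\<V>'. openin (subtopology X C) V"
    using V(1) by (auto simp: \<V>'_def openin_subtopology_Int)
  moreover have un: "\<Union>\<V>' = topspace (subtopology X C)"
  proof -
    have "\<Union>\<V>' = \<Union>\<V> \<inter> C" by (auto simp: \<V>'_def)
    with V(2) show ?thesis by simp
  qed
  moreover have "\<forall>V\<in>\<V>'. \<exists>U\<in>\<U>. V \<subseteq> U"
  proof
    fix V' assume "V' \<in> \<V>'"
    then obtain V where "V \<in> \<V>" "V' = V \<inter> C" "V \<inter> C \<noteq> {}" by (auto simp: \<V>'_def)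
    moreover then obtain W where "W \<in> \<W>" "V \<subseteq> W" using V(3) by blast
    ultimately have "W \<inter> C \<in> \<U>" "V' \<subseteq> W \<inter> C" by (auto simp: \<W>_def)
    then show "\<exists>U\<in>\<U>. V' \<subseteq> U" by blast
  qed
  moreover have "locally_finite_in (subtopology X C) \<V>'"
    unfolding locally_finite_in_def
  proof (intro conjI ballI)
    show "\<Union>\<V>' \<subseteq> topspace (subtopology X C)" using un by simp
    fix x assume x: "x \<in> topspace (subtopology X C)"
    then obtain O1 where O1: "openin X O1" "x \<in> O1" "finite {U \<in> \<V>. U \<inter> O1 \<noteq> {}}"
      using V(4) unfolding locally_finite_in_def by auto
    have "{U \<in> \<V>'. U \<inter> (O1 \<inter> C) \<noteq> {}} \<subseteq> (\<lambda>V. V \<inter> C) ` {U \<in> \<V>. U \<inter> O1 \<noteq> {}}"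
      by (auto simp: \<V>'_def)
    then have "finite {U \<in> \<V>'. U \<inter> (O1 \<inter> C) \<noteq> {}}"
      using O1(3) finite_surj by blast
    then show "\<exists>V. openin (subtopology X C) V \<and> x \<in> V \<and> finite {U \<in> \<V>'. U \<inter> V \<noteq> {}}"
      using O1 x by (intro exI[of _ "O1 \<inter> C"]) (auto simp: openin_subtopology_Int)
  qed
  ultimately show "\<exists>\<V>. (\<forall>V\<in>\<V>. openin (subtopology X C) V) \<and> \<Union>\<V> = topspace (subtopology X C) \<and>
      (\<forall>V\<in>\<V>. \<exists>U\<in>\<U>. V \<subseteq> U) \<and> locally_finite_in (subtopology X C) \<V>" by blast
qed

section \<open>Groupoids and bundles\<close>

locale top_groupoid =
  fixes G :: "('o, 'g) groupoid"
  assumes topological_groupoid: "topological_groupoid G"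
begin

lemma cgh_Obj: "cgh_space (Obj G)" and cgh_Arr: "cgh_space (Arr G)"
  and continuous_idt: "continuous_map (Obj G) (Arr G) (idt G)"
  and continuous_src: "continuous_map (Arr G) (Obj G) (src G)"
  and continuous_tgt: "continuous_map (Arr G) (Obj G) (tgt G)"
  and continuous_ginv: "continuous_map (Arr G) (Arr G) (ginv G)"
  using topological_groupoid unfolding topological_groupoid_def by simp_all

lemma Hausdorff_Obj: "Hausdorff_space (Obj G)"
  using cgh_Obj by (simp add: cgh_space_def)

lemma continuous_gcomp:
  assumes "k_space Z" "continuous_map Z (Arr G) f" "continuous_map Z (Arr G) g"
    and "\<And>z. z \<in> topspace Z \<Longrightarrow> src G (f z) = tgt G (g z)"
  shows "continuous_map Z (Arr G) (\<lambda>z. gcomp G (f z) (g z))"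
proof -
  have "continuous_map Z (composable G) (\<lambda>z. (f z, g z))"
    unfolding composable_def
    by (rule continuous_map_into_subtopology)
       (use assms continuous_map_kprod_Pair in auto)
  moreover have "continuous_map (composable G) (Arr G) (\<lambda>(g, h). gcomp G g h)"
    using topological_groupoid unfolding topological_groupoid_def by simp
  ultimately show ?thesis
    using continuous_map_compose by (fastforce simp: o_def)
qed

lemma src_in [simp]: "g \<in> topspace (Arr G) \<Longrightarrow> src G g \<in> topspace (Obj G)"
  and tgt_in [simp]: "g \<in> topspace (Arr G) \<Longrightarrow> tgt G g \<in> topspace (Obj G)"
  and ginv_in [simp]: "g \<in> topspace (Arr G) \<Longrightarrow> ginv G g \<in> topspace (Arr G)"
  and idt_in [simp]: "x \<in> topspace (Obj G) \<Longrightarrow> idt G x \<in> topspace (Arr G)"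
  using continuous_src continuous_tgt continuous_ginv continuous_idt
  by (auto simp: continuous_map_def)

lemma gcomp_in [simp]:
  assumes "g \<in> topspace (Arr G)" "h \<in> topspace (Arr G)" "src G g = tgt G h"
  shows "gcomp G g h \<in> topspace (Arr G)"
proof -
  have "continuous_map (composable G) (Arr G) (\<lambda>(g, h). gcomp G g h)"
    using topological_groupoid unfolding topological_groupoid_def by simp
  moreover have "(g, h) \<in> topspace (composable G)"
    using assms by (simp add: composable_def)
  ultimately show ?thesis using continuous_map_into_topspace by fastforce
qed

lemma src_idt [simp]: "x \<in> topspace (Obj G) \<Longrightarrow> src G (idt G x) = x"
  and tgt_idt [simp]: "x \<in> topspace (Obj G) \<Longrightarrow> tgt G (idt G x) = x"
  and src_gcomp [simp]: "\<lbrakk>g \<in> topspace (Arr G); h \<in> topspace (Arr G); src G g = tgt G h\<rbrakk>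
        \<Longrightarrow> src G (gcomp G g h) = src G h"
  and tgt_gcomp [simp]: "\<lbrakk>g \<in> topspace (Arr G); h \<in> topspace (Arr G); src G g = tgt G h\<rbrakk>
        \<Longrightarrow> tgt G (gcomp G g h) = tgt G g"
  and gcomp_assoc: "\<lbrakk>g \<in> topspace (Arr G); h \<in> topspace (Arr G); k \<in> topspace (Arr G);
        src G g = tgt G h; src G h = tgt G k\<rbrakk>
        \<Longrightarrow> gcomp G (gcomp G g h) k = gcomp G g (gcomp G h k)"
  and gcomp_idt_right [simp]: "g \<in> topspace (Arr G) \<Longrightarrow> src G g = x \<Longrightarrow> gcomp G g (idt G x) = g"
  and gcomp_idt_left [simp]: "g \<in> topspace (Arr G) \<Longrightarrow> tgt G g = x \<Longrightarrow> gcomp G (idt G x) g = g"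
  and src_ginv [simp]: "g \<in> topspace (Arr G) \<Longrightarrow> src G (ginv G g) = tgt G g"
  and tgt_ginv [simp]: "g \<in> topspace (Arr G) \<Longrightarrow> tgt G (ginv G g) = src G g"
  and gcomp_ginv_right [simp]: "g \<in> topspace (Arr G) \<Longrightarrow> gcomp G g (ginv G g) = idt G (tgt G g)"
  and gcomp_ginv_left [simp]: "g \<in> topspace (Arr G) \<Longrightarrow> gcomp G (ginv G g) g = idt G (src G g)"
  using topological_groupoid unfolding topological_groupoid_def by auto

end

text \<open>The division map of a principal bundle: the arrow g with p g = q. Being a description,
  it makes sense before the bundle axioms are known, and the associated bundle uses it in this
  way.\<close>

definition translation :: "('o, 'g) groupoid \<Rightarrow> ('p, 'm, 'o, 'g) gbundle \<Rightarrow> 'p \<Rightarrow> 'p \<Rightarrow> 'g" where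
  "translation G P p q = (THE g. g \<in> topspace (Arr G) \<and> anchor P p = tgt G g \<and> act P p g = q)"

text \<open>A principal bundle up to paracompactness, which fails to be inherited by associated
  bundles and pullbacks.\<close>

locale prebundle = top_groupoid G for G :: "('o, 'g) groupoid" +
  fixes M :: "'m topology" and P :: "('p, 'm, 'o, 'g) gbundle"
  assumes cgh_base: "cgh_space M"
    and continuous_proj: "continuous_map (total_space P) M (proj P)"
    and right_space: "right_space G (total_space P) (anchor P) (act P)"
    and local_sections: "admits_local_sections (total_space P) M (proj P)"
    and proj_act [simp]: "\<lbrakk>p \<in> topspace (total_space P); g \<in> topspace (Arr G); anchor P p = tgt G g\<rbrakk>
          \<Longrightarrow> proj P (act P p g) = proj P p"
    and shear: "homeomorphic_map
       (subtopology (kprod_topology (total_space P) (Arr G)) {(p, g). anchor P p = tgt G g})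
       (subtopology (kprod_topology (total_space P) (total_space P)) {(p, q). proj P p = proj P q})
       (\<lambda>(p, g). (p, act P p g))"
begin

section \<open>Consequences of the shear homeomorphism\<close>

lemma cgh_total: "cgh_space (total_space P)"
  and continuous_anchor: "continuous_map (total_space P) (Obj G) (anchor P)"
  and anchor_act [simp]: "\<lbrakk>p \<in> topspace (total_space P); g \<in> topspace (Arr G); anchor P p = tgt G g\<rbrakk>
          \<Longrightarrow> anchor P (act P p g) = src G g"
  and act_idt [simp]: "p \<in> topspace (total_space P) \<Longrightarrow> anchor P p = x \<Longrightarrow> act P p (idt G x) = p"
  and act_act: "\<lbrakk>p \<in> topspace (total_space P); g \<in> topspace (Arr G); h \<in> topspace (Arr G);
          anchor P p = tgt G g; src G g = tgt G h\<rbrakk>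
          \<Longrightarrow> act P (act P p g) h = act P p (gcomp G g h)"
  using right_space unfolding right_space_def by auto

lemma proj_in [simp]: "p \<in> topspace (total_space P) \<Longrightarrow> proj P p \<in> topspace M"
  and anchor_in [simp]: "p \<in> topspace (total_space P) \<Longrightarrow> anchor P p \<in> topspace (Obj G)"
  using continuous_proj continuous_anchor by (auto simp: continuous_map_def)

lemma continuous_act:
  assumes "k_space Z" "continuous_map Z (total_space P) f" "continuous_map Z (Arr G) g"
    and "\<And>z. z \<in> topspace Z \<Longrightarrow> anchor P (f z) = tgt G (g z)"
  shows "continuous_map Z (total_space P) (\<lambda>z. act P (f z) (g z))"
proof -
  let ?D = "subtopology (kprod_topology (total_space P) (Arr G)) {(p, g). anchor P p = tgt G g}"
  have "continuous_map Z ?D (\<lambda>z. (f z, g z))"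
    by (rule continuous_map_into_subtopology)
       (use assms continuous_map_kprod_Pair in auto)
  moreover have "continuous_map ?D (total_space P) (\<lambda>(p, g). act P p g)"
    using right_space unfolding right_space_def by simp
  ultimately show ?thesis
    using continuous_map_compose by (fastforce simp: o_def)
qed

lemma act_in [simp]:
  assumes "p \<in> topspace (total_space P)" "g \<in> topspace (Arr G)" "anchor P p = tgt G g"
  shows "act P p g \<in> topspace (total_space P)"
proof -
  let ?D = "subtopology (kprod_topology (total_space P) (Arr G)) {(p, g). anchor P p = tgt G g}"
  have "continuous_map ?D (total_space P) (\<lambda>(p, g). act P p g)"
    using right_space unfolding right_space_def by simp
  moreover have "(p, g) \<in> topspace ?D" using assms by simp
  ultimately show ?thesis using continuous_map_into_topspace by fastforce
qed

text \<open>Surjectivity of the shear map says that the action is transitive on the fibres of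
  \<open>proj P\<close>; its injectivity, used in \<open>act_inj\<close>, says that the action is
  free.\<close>

lemma translation_ex:
  assumes "p \<in> topspace (total_space P)" "q \<in> topspace (total_space P)" "proj P p = proj P q"
  shows "\<exists>g. g \<in> topspace (Arr G) \<and> anchor P p = tgt G g \<and> act P p g = q"
proof -
  have "(p, q) \<in> topspace (subtopology (kprod_topology (total_space P) (total_space P))
      {(p, q). proj P p = proj P q})" using assms by simp
  then have "(p, q) \<in> (\<lambda>(p, g). (p, act P p g)) `
      topspace (subtopology (kprod_topology (total_space P) (Arr G)) {(p, g). anchor P p = tgt G g})"
    using homeomorphic_imp_surjective_map[OF shear] by simp
  then show ?thesis by (auto simp del: topspace_subtopology simp add: topspace_subtopology[of "kprod_topology _ _"])
qed

lemma act_inj: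
  assumes "p \<in> topspace (total_space P)" "g \<in> topspace (Arr G)" "anchor P p = tgt G g"
    and "h \<in> topspace (Arr G)" "anchor P p = tgt G h" "act P p g = act P p h"
  shows "g = h"
  using inj_onD[OF homeomorphic_imp_injective_map[OF shear], of "(p, g)" "(p, h)"] assms by simp

lemma translation_act [simp]:
  assumes "p \<in> topspace (total_space P)" "g \<in> topspace (Arr G)" "anchor P p = tgt G g"
  shows "translation G P p (act P p g) = g"
  unfolding translation_def by (rule the_equality) (use assms act_inj in auto)

lemma translation:
  assumes "p \<in> topspace (total_space P)" "q \<in> topspace (total_space P)" "proj P p = proj P q"
  shows translation_in [simp]: "translation G P p q \<in> topspace (Arr G)"
    and tgt_translation [simp]: "tgt G (translation G P p q) = anchor P p"
    and act_translation [simp]: "act P p (translation G P p q) = q"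
    and src_translation [simp]: "src G (translation G P p q) = anchor P q"
proof -
  obtain g where g: "g \<in> topspace (Arr G)" "anchor P p = tgt G g" "act P p g = q"
    using translation_ex[OF assms] by blast
  then have "translation G P p q = g" using assms(1) by auto
  with g assms(1) show "translation G P p q \<in> topspace (Arr G)"
    "tgt G (translation G P p q) = anchor P p" "act P p (translation G P p q) = q"
    "src G (translation G P p q) = anchor P q" by auto
qed

lemma translation_eqI:
  assumes "p \<in> topspace (total_space P)" "g \<in> topspace (Arr G)" "anchor P p = tgt G g" "act P p g = q"
  shows "translation G P p q = g"
  using assms by auto

text \<open>The translation is the second component of the inverse k of the shear map.\<close>

lemma continuous_translation:
  assumes Z: "k_space Z" "continuous_map Z (total_space P) f" "continuous_map Z (total_space P) g"
    and eq: "\<And>z. z \<in> topspace Z \<Longrightarrow> proj P (f z) = proj P (g z)"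
  shows "continuous_map Z (Arr G) (\<lambda>z. translation G P (f z) (g z))"
proof -
  let ?D = "subtopology (kprod_topology (total_space P) (Arr G)) {(p, g). anchor P p = tgt G g}"
  let ?F = "subtopology (kprod_topology (total_space P) (total_space P)) {(p, q). proj P p = proj P q}"
  obtain k where k: "homeomorphic_maps ?D ?F (\<lambda>(p, g). (p, act P p g)) k"
    using shear homeomorphic_map_maps by blast
  have fg: "continuous_map Z ?F (\<lambda>z. (f z, g z))"
    by (rule continuous_map_into_subtopology)
       (use assms continuous_map_kprod_Pair in auto)
  have "continuous_map ?D (Arr G) snd"
    using continuous_map_kprod_snd continuous_map_from_subtopology by blast
  moreover have "continuous_map ?F ?D k" using k by (simp add: homeomorphic_maps_def)
  ultimately have "continuous_map Z (Arr G) (snd \<circ> (k \<circ> (\<lambda>z. (f z, g z))))"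
    by (intro continuous_map_compose[OF continuous_map_compose[OF fg]])
  then show ?thesis
  proof (rule continuous_map_eq)
    fix z assume z: "z \<in> topspace Z"
    then have fz: "f z \<in> topspace (total_space P)" "g z \<in> topspace (total_space P)"
      using Z by (auto simp: continuous_map_def)
    let ?t = "translation G P (f z) (g z)"
    \<comment> \<open>This is the point that the shear map sends to \<open>(f z, g z)\<close>, so k
      returns it.\<close>
    have "(f z, ?t) \<in> topspace ?D" using fz eq[OF z] by simp
    moreover have "\<forall>x\<in>topspace ?D. k ((\<lambda>(p, g). (p, act P p g)) x) = x"
      using k unfolding homeomorphic_maps_def by (elim conjE)
    ultimately have "k ((\<lambda>(p, g). (p, act P p g)) (f z, ?t)) = (f z, ?t)" by blast
    then show "(snd \<circ> (k \<circ> (\<lambda>z. (f z, g z)))) z = ?t" using fz eq[OF z] by simp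
  qed
qed

text \<open>Both sides carry p to r, and the action is free. This cocycle identity is what makes
  extensions by equivariance independent of the reference point.\<close>

lemma translation_trans:
  assumes "p \<in> topspace (total_space P)" "q \<in> topspace (total_space P)" "r \<in> topspace (total_space P)"
    and "proj P p = proj P q" "proj P q = proj P r"
  shows "translation G P p r = gcomp G (translation G P p q) (translation G P q r)"
  by (rule translation_eqI) (use assms in \<open>simp_all flip: act_act\<close>)

lemma translation_act_right:
  assumes "p \<in> topspace (total_space P)" "q \<in> topspace (total_space P)" "proj P p = proj P q"
    and "g \<in> topspace (Arr G)" "anchor P q = tgt G g"
  shows "translation G P p (act P q g) = gcomp G (translation G P p q) g"
  by (rule translation_eqI) (use assms in \<open>simp_all flip: act_act\<close>)

lemma local_lift:
  assumes m: "continuous_map Z M m" and z: "z \<in> topspace Z"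
  shows "\<exists>W s. openin Z W \<and> z \<in> W \<and> continuous_map (subtopology Z W) (total_space P) s \<and>
    (\<forall>w\<in>W. proj P (s w) = m w)"
proof -
  have "m z \<in> topspace M" using m z by (auto simp: continuous_map_def)
  then obtain U \<sigma> where U: "openin M U" "m z \<in> U"
    "continuous_map (subtopology M U) (total_space P) \<sigma>" "\<forall>u\<in>U. proj P (\<sigma> u) = u"
    using local_sections unfolding admits_local_sections_def by blast
  let ?W = "{w \<in> topspace Z. m w \<in> U}"
  have "continuous_map (subtopology Z ?W) (subtopology M U) m"
    using m by (auto simp: continuous_map_in_subtopology continuous_map_from_subtopology)
  then have "continuous_map (subtopology Z ?W) (total_space P) (\<sigma> \<circ> m)"
    using U(3) continuous_map_compose by blast
  moreover have "openin Z ?W" using m U(1) openin_continuous_map_preimage by blast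
  ultimately show ?thesis using U z by (intro exI[of _ ?W] exI[of _ "\<sigma> \<circ> m"]) auto
qed

lemma proj_surj: "m \<in> topspace M \<Longrightarrow> \<exists>p\<in>topspace (total_space P). proj P p = m"
proof -
  assume "m \<in> topspace M"
  then obtain W s where "openin M W" "m \<in> W" "continuous_map (subtopology M W) (total_space P) s"
    "\<forall>w\<in>W. proj P (s w) = w"
    using local_lift[OF continuous_map_id] unfolding id_def by blast
  moreover then have "s m \<in> topspace (total_space P)"
    using continuous_map_into_topspace openin_subset by fastforce
  ultimately show ?thesis by blast
qed

text \<open>Continuity is local, and locally m lifts to P. So a map whose value at z can be computed
  from any point of P over \<open>m z\<close> may be tested with a continuously varying choice
  \<open>s\<close> of that point. The premise offers the facts about W and s that such a test
  uses.\<close>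

lemma continuous_map_by_lifts:
  assumes Z: "cgh_space Z" and m: "continuous_map Z M m"
    and *: "\<And>W s. \<lbrakk>openin Z W; topspace (subtopology Z W) = W; k_space (subtopology Z W);
        continuous_map (subtopology Z W) (total_space P) s;
        \<And>w. w \<in> W \<Longrightarrow> w \<in> topspace Z; \<And>w. w \<in> W \<Longrightarrow> s w \<in> topspace (total_space P);
        \<And>w. w \<in> W \<Longrightarrow> proj P (s w) = m w\<rbrakk> \<Longrightarrow> continuous_map (subtopology Z W) Y f"
  shows "continuous_map Z Y f"
proof (rule continuous_map_locally)
  fix z assume "z \<in> topspace Z"
  then obtain W s where W: "openin Z W" "z \<in> W"
    "continuous_map (subtopology Z W) (total_space P) s" "\<forall>w\<in>W. proj P (s w) = m w"
    using local_lift[OF m] by blast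
  have "topspace (subtopology Z W) = W" using W(1) openin_subset by auto
  moreover then have "s w \<in> topspace (total_space P)" if "w \<in> W" for w
    using W(3) that by (auto simp: continuous_map_def)
  ultimately have "continuous_map (subtopology Z W) Y f"
    using W Z k_space_cgh[OF cgh_space_open_subtopology[OF Z W(1)]] by (intro *[of W s]) auto
  with W show "\<exists>U. openin Z U \<and> z \<in> U \<and> continuous_map (subtopology Z U) Y f" by blast
qed

end

text \<open>The inverse of the shear map is (p, q) \<mapsto> (p, d p q): \<open>d1\<close> and
  \<open>d2\<close> are the two inverse laws and \<open>d\<close> is its continuity. Finding a
  continuous formula for the division map thus replaces proving a homeomorphism.\<close>

lemma prebundleI:
  assumes G: "topological_groupoid G" and M: "cgh_space M"
    and proj: "continuous_map (total_space P) M (proj P)"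
    and rs: "right_space G (total_space P) (anchor P) (act P)"
    and ls: "admits_local_sections (total_space P) M (proj P)"
    and pa: "\<And>p g. \<lbrakk>p \<in> topspace (total_space P); g \<in> topspace (Arr G); anchor P p = tgt G g\<rbrakk>
          \<Longrightarrow> proj P (act P p g) = proj P p"
    and d: "continuous_map (subtopology (kprod_topology (total_space P) (total_space P))
           {(p, q). proj P p = proj P q}) (Arr G) (\<lambda>(p, q). d p q)"
    and d1: "\<And>p q. \<lbrakk>p \<in> topspace (total_space P); q \<in> topspace (total_space P); proj P p = proj P q\<rbrakk>
          \<Longrightarrow> tgt G (d p q) = anchor P p \<and> act P p (d p q) = q"
    and d2: "\<And>p g. \<lbrakk>p \<in> topspace (total_space P); g \<in> topspace (Arr G); anchor P p = tgt G g\<rbrakk>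
          \<Longrightarrow> d p (act P p g) = g"
  shows "prebundle G M P"
proof
  interpret top_groupoid G by unfold_locales (rule G)
  let ?X = "total_space P"
  let ?D = "subtopology (kprod_topology ?X (Arr G)) {(p, g). anchor P p = tgt G g}"
  let ?F = "subtopology (kprod_topology ?X ?X) {(p, q). proj P p = proj P q}"
  have X: "cgh_space ?X" and an: "continuous_map ?X (Obj G) (anchor P)"
    and ac: "continuous_map ?D ?X (\<lambda>(x, g). act P x g)"
    using rs unfolding right_space_def by auto
  have D: "k_space ?D"
    by (rule k_space_cgh[OF cgh_space_fibre_product[OF X cgh_Arr Hausdorff_Obj an continuous_tgt]])
  have F: "k_space ?F"
    using M by (intro k_space_cgh cgh_space_fibre_product[OF X X _ proj proj]) (simp add: cgh_space_def)
  have actin: "act P p g \<in> topspace ?X"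
    if "p \<in> topspace ?X" "g \<in> topspace (Arr G)" "anchor P p = tgt G g" for p g
  proof -
    have "(p, g) \<in> topspace ?D" using that by simp
    then show ?thesis using continuous_map_into_topspace[OF ac] by fastforce
  qed
  have din: "d p q \<in> topspace (Arr G)"
    if "p \<in> topspace ?X" "q \<in> topspace ?X" "proj P p = proj P q" for p q
  proof -
    have "(p, q) \<in> topspace ?F" using that by simp
    then show ?thesis using continuous_map_into_topspace[OF d] by fastforce
  qed
  have "homeomorphic_maps ?D ?F (\<lambda>(p, g). (p, act P p g)) (\<lambda>(p, q). (p, d p q))"
    unfolding homeomorphic_maps_def
  proof (intro conjI ballI)
    have "continuous_map ?D (kprod_topology ?X ?X) (\<lambda>z. (fst z, (\<lambda>(p, g). act P p g) z))"
      by (rule continuous_map_kprod_Pair[OF D _ ac])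
         (rule continuous_map_kprod_fst_sub)
    then show "continuous_map ?D ?F (\<lambda>(p, g). (p, act P p g))"
      by (auto simp: continuous_map_in_subtopology pa case_prod_unfold)
    have "continuous_map ?F (kprod_topology ?X (Arr G)) (\<lambda>z. (fst z, (\<lambda>(p, q). d p q) z))"
      by (rule continuous_map_kprod_Pair[OF F _ d])
         (rule continuous_map_kprod_fst_sub)
    then show "continuous_map ?F ?D (\<lambda>(p, q). (p, d p q))"
      by (auto simp: continuous_map_in_subtopology d1 case_prod_unfold)
  qed (auto simp: d1 d2)
  then show "homeomorphic_map ?D ?F (\<lambda>(p, g). (p, act P p g))"
    using homeomorphic_map_maps by blast
qed (use assms in auto)

lemma principal_bundle_imp_prebundle:
  assumes "topological_groupoid G" "principal_bundle G M P"
  shows "prebundle G M P"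
  using assms unfolding principal_bundle_def base_space_def
  by unfold_locales auto

lemma (in prebundle) principal_bundle:
  assumes "base_space M" "paracompact_space (total_space P)"
  shows "principal_bundle G M P"
proof -
  have "proj P ` topspace (total_space P) = topspace M"
    using proj_surj by fastforce
  then show ?thesis
    unfolding principal_bundle_def
    using assms continuous_proj right_space local_sections shear by auto
qed

subsection \<open>Isomorphisms\<close>

text \<open>A morphism of principal bundles over the same base is invertible. It is injective
  because the action on Q is free, and it is onto because the action on Q is transitive on fibres
  and P has points over every point of M. Its inverse is continuous because it can be written with
  the division map of Q and local sections of P.\<close>

lemma bundle_isomorphicI:
  assumes P: "prebundle G M P" and Q: "prebundle G M Q"
    and \<phi>: "continuous_map (total_space P) (total_space Q) \<phi>"
    and \<phi>_proj: "\<And>p. p \<in> topspace (total_space P) \<Longrightarrow> proj Q (\<phi> p) = proj P p"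
    and \<phi>_anchor: "\<And>p. p \<in> topspace (total_space P) \<Longrightarrow> anchor Q (\<phi> p) = anchor P p"
    and \<phi>_act: "\<And>p g. \<lbrakk>p \<in> topspace (total_space P); g \<in> topspace (Arr G); anchor P p = tgt G g\<rbrakk>
          \<Longrightarrow> \<phi> (act P p g) = act Q (\<phi> p) g"
  shows "bundle_isomorphic G P Q"
proof -
  interpret P: prebundle G M P by (rule P)
  interpret Q: prebundle G M Q by (rule Q)
  let ?X = "total_space P" and ?Y = "total_space Q"
  have \<phi>_in [simp]: "\<phi> p \<in> topspace ?Y" if "p \<in> topspace ?X" for p
    using continuous_map_into_topspace[OF \<phi> that] .
  have inj: "inj_on \<phi> (topspace ?X)"
  proof (rule inj_onI)
    fix p p' assume p: "p \<in> topspace ?X" "p' \<in> topspace ?X" and eq: "\<phi> p = \<phi> p'"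
    have pr: "proj P p = proj P p'" using \<phi>_proj p eq by metis
    have an: "anchor P p = anchor P p'" using \<phi>_anchor p eq by metis
    let ?g = "translation G P p p'"
    have "\<phi> p' = act Q (\<phi> p) ?g" using \<phi>_act[of p ?g] p pr by simp
    \<comment> \<open>Both \<open>?g\<close> and a unit fix \<open>\<phi> p\<close>, so freeness in
      Q makes them equal, and then p' = p.\<close>
    then have "translation G Q (\<phi> p) (\<phi> p) = ?g"
      using p pr an eq \<phi>_anchor by (intro Q.translation_eqI) auto
    moreover have "translation G Q (\<phi> p) (\<phi> p) = idt G (anchor P p)"
      using p \<phi>_anchor by (intro Q.translation_eqI) auto
    ultimately show "p = p'" using p pr P.act_translation[of p p'] P.act_idt[of p] by metis
  qed
  define \<psi> where "\<psi> = inv_into (topspace ?X) \<phi>"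
  \<comment> \<open>The arrow that moves \<open>\<phi> p\<close> to q also moves p to the preimage
    of q, for every p over the base point of q. Choosing p by a local lift therefore gives a
    continuous formula for \<open>\<psi>\<close>.\<close>
  have lift: "\<phi> (act P p (translation G Q (\<phi> p) q)) = q \<and>
      act P p (translation G Q (\<phi> p) q) \<in> topspace ?X"
    if "p \<in> topspace ?X" "q \<in> topspace ?Y" "proj P p = proj Q q" for p q
    using that by (simp add: \<phi>_act \<phi>_proj \<phi>_anchor)
  have \<psi>: "\<psi> q = act P p (translation G Q (\<phi> p) q)"
    if "p \<in> topspace ?X" "q \<in> topspace ?Y" "proj P p = proj Q q" for p q
    using lift[OF that] inv_into_f_f[OF inj] unfolding \<psi>_def by metis
  have "continuous_map ?Y ?X \<psi>"
  proof (rule P.continuous_map_by_lifts[OF Q.cgh_total Q.continuous_proj])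
    fix W s
    assume W: "openin ?Y W" "topspace (subtopology ?Y W) = W" "k_space (subtopology ?Y W)"
      and s: "continuous_map (subtopology ?Y W) ?X s"
      and wY: "\<And>w. w \<in> W \<Longrightarrow> w \<in> topspace ?Y"
      and sX: "\<And>w. w \<in> W \<Longrightarrow> s w \<in> topspace ?X"
      and ps: "\<And>w. w \<in> W \<Longrightarrow> proj P (s w) = proj Q w"
    have "continuous_map (subtopology ?Y W) (Arr G) (\<lambda>w. translation G Q (\<phi> (s w)) w)"
    proof (rule Q.continuous_translation[OF W(3)])
      show "continuous_map (subtopology ?Y W) ?Y (\<lambda>w. \<phi> (s w))"
        using continuous_map_compose[OF s \<phi>] by (simp add: o_def)
      show "continuous_map (subtopology ?Y W) ?Y (\<lambda>w. w)"
        by (simp add: continuous_map_from_subtopology)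
    qed (simp only: W(2) \<phi>_proj sX ps)
    then have "continuous_map (subtopology ?Y W) ?X (\<lambda>w. act P (s w) (translation G Q (\<phi> (s w)) w))"
      by (rule P.continuous_act[OF W(3) s])
         (simp only: W(2) Q.tgt_translation \<phi>_in \<phi>_anchor \<phi>_proj sX ps wY)
    then show "continuous_map (subtopology ?Y W) ?X \<psi>"
      by (rule continuous_map_eq) (metis W(2) \<psi> sX wY ps)
  qed
  moreover have "\<forall>p\<in>topspace ?X. \<psi> (\<phi> p) = p"
    using inj unfolding \<psi>_def by simp
  moreover have "\<forall>q\<in>topspace ?Y. \<phi> (\<psi> q) = q"
  proof
    fix q assume q: "q \<in> topspace ?Y"
    then obtain p where "p \<in> topspace ?X" "proj P p = proj Q q" using P.proj_surj by force
    with q show "\<phi> (\<psi> q) = q" using lift \<psi> by simp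
  qed
  ultimately have "homeomorphic_maps ?X ?Y \<phi> \<psi>" using \<phi> by (simp add: homeomorphic_maps_def)
  then have "homeomorphic_map ?X ?Y \<phi>" using homeomorphic_map_maps by blast
  then show ?thesis unfolding bundle_isomorphic_def
    using \<phi>_proj \<phi>_anchor \<phi>_act by blast
qed

text \<open>Equivariance of the inverse is read off after applying \<open>\<phi>\<close>. That needs
  \<open>act P (\<psi> q) g\<close> to lie in the total space of P, which is why prebundles are
  assumed here and not in \<open>bundle_isomorphic_trans\<close>.\<close>

lemma bundle_isomorphic_sym:
  assumes P: "prebundle G M P" and Q: "prebundle G M Q" and iso: "bundle_isomorphic G P Q"
  shows "bundle_isomorphic G Q P"
proof -
  interpret P: prebundle G M P by (rule P)
  obtain \<phi> where hom: "homeomorphic_map (total_space P) (total_space Q) \<phi>"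
    and pa: "\<forall>p\<in>topspace (total_space P). proj Q (\<phi> p) = proj P p \<and> anchor Q (\<phi> p) = anchor P p"
    and ac: "\<forall>p\<in>topspace (total_space P). \<forall>g\<in>topspace (Arr G). anchor P p = tgt G g \<longrightarrow>
           \<phi> (act P p g) = act Q (\<phi> p) g"
    using iso unfolding bundle_isomorphic_def by blast
  obtain \<psi> where hm: "homeomorphic_maps (total_space P) (total_space Q) \<phi> \<psi>"
    using hom homeomorphic_map_maps by blast
  then have c: "continuous_map (total_space Q) (total_space P) \<psi>"
    and \<psi>: "\<And>p. p \<in> topspace (total_space P) \<Longrightarrow> \<psi> (\<phi> p) = p"
    and \<phi>: "\<And>q. q \<in> topspace (total_space Q) \<Longrightarrow> \<phi> (\<psi> q) = q"
    by (auto simp: homeomorphic_maps_def)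
  note \<psi>_in = continuous_map_into_topspace[OF c]
  show ?thesis
  proof (rule bundle_isomorphicI[OF Q P c])
    fix q assume q: "q \<in> topspace (total_space Q)"
    show "proj P (\<psi> q) = proj Q q" "anchor P (\<psi> q) = anchor Q q"
      using pa \<psi>_in[OF q] \<phi>[OF q] by metis+
    fix g assume g: "g \<in> topspace (Arr G)" "anchor Q q = tgt G g"
    have an: "anchor P (\<psi> q) = tgt G g" using pa \<psi>_in[OF q] \<phi>[OF q] g by metis
    then have "\<phi> (act P (\<psi> q) g) = act Q q g" using ac \<psi>_in[OF q] \<phi>[OF q] g by simp
    moreover have "\<psi> (\<phi> (act P (\<psi> q) g)) = act P (\<psi> q) g"
      using \<psi>_in[OF q] g an by (intro \<psi>) simp
    ultimately show "\<psi> (act Q q g) = act P (\<psi> q) g" by simp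
  qed
qed

lemma bundle_isomorphicE:
  assumes "bundle_isomorphic G P Q"
  obtains \<phi> where "continuous_map (total_space P) (total_space Q) \<phi>"
    and "\<And>p. p \<in> topspace (total_space P) \<Longrightarrow> \<phi> p \<in> topspace (total_space Q)"
    and "\<And>p. p \<in> topspace (total_space P) \<Longrightarrow> proj Q (\<phi> p) = proj P p"
    and "\<And>p. p \<in> topspace (total_space P) \<Longrightarrow> anchor Q (\<phi> p) = anchor P p"
    and "\<And>p g. \<lbrakk>p \<in> topspace (total_space P); g \<in> topspace (Arr G); anchor P p = tgt G g\<rbrakk>
          \<Longrightarrow> \<phi> (act P p g) = act Q (\<phi> p) g"
proof -
  obtain \<phi> where hom: "homeomorphic_map (total_space P) (total_space Q) \<phi>"
    and "\<forall>p\<in>topspace (total_space P). proj Q (\<phi> p) = proj P p \<and> anchor Q (\<phi> p) = anchor P p"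
    and "\<forall>p\<in>topspace (total_space P). \<forall>g\<in>topspace (Arr G). anchor P p = tgt G g \<longrightarrow>
           \<phi> (act P p g) = act Q (\<phi> p) g"
    using assms unfolding bundle_isomorphic_def by blast
  moreover have c: "continuous_map (total_space P) (total_space Q) \<phi>"
    using hom homeomorphic_imp_continuous_map by blast
  ultimately show thesis
    using that[OF c continuous_map_into_topspace[OF c]] by blast
qed

lemma bundle_isomorphic_trans:
  assumes "bundle_isomorphic G P Q" "bundle_isomorphic G Q R"
  shows "bundle_isomorphic G P R"
proof -
  obtain \<phi> where "homeomorphic_map (total_space P) (total_space Q) \<phi>"
    and 1: "\<forall>p\<in>topspace (total_space P). proj Q (\<phi> p) = proj P p \<and> anchor Q (\<phi> p) = anchor P p"
    and 2: "\<forall>p\<in>topspace (total_space P). \<forall>g\<in>topspace (Arr G). anchor P p = tgt G g \<longrightarrow>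
           \<phi> (act P p g) = act Q (\<phi> p) g"
    using assms(1) unfolding bundle_isomorphic_def by blast
  moreover obtain \<psi> where "homeomorphic_map (total_space Q) (total_space R) \<psi>"
    and 3: "\<forall>p\<in>topspace (total_space Q). proj R (\<psi> p) = proj Q p \<and> anchor R (\<psi> p) = anchor Q p"
    and 4: "\<forall>p\<in>topspace (total_space Q). \<forall>g\<in>topspace (Arr G). anchor Q p = tgt G g \<longrightarrow>
           \<psi> (act Q p g) = act R (\<psi> p) g"
    using assms(2) unfolding bundle_isomorphic_def by blast
  ultimately have "homeomorphic_map (total_space P) (total_space R) (\<psi> \<circ> \<phi>)"
    and "\<And>p. p \<in> topspace (total_space P) \<Longrightarrow> \<phi> p \<in> topspace (total_space Q)"
    using homeomorphic_map_compose homeomorphic_imp_surjective_map by blast+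
  then show ?thesis unfolding bundle_isomorphic_def
    using 1 2 3 4 by (intro exI[of _ "\<psi> \<circ> \<phi>"]) simp
qed

subsection \<open>Pullbacks\<close>

lemma pullback_bundle_simps [simp]:
  "total_space (pullback_bundle N F P) =
     subtopology (kprod_topology N (total_space P)) {(x, p). F x = proj P p}"
  "proj (pullback_bundle N F P) = fst"
  "anchor (pullback_bundle N F P) = (\<lambda>z. anchor P (snd z))"
  "act (pullback_bundle N F P) = (\<lambda>z g. (fst z, act P (snd z) g))"
  by (simp_all add: pullback_bundle_def case_prod_unfold)

text \<open>All structure sits in the second coordinate: the division map is the translation of P
  there, and a lift s of F along \<open>proj P\<close> gives the section w \<mapsto> (w, s w).
  Nothing is claimed about paracompactness.\<close>

lemma prebundle_pullback:
  assumes P: "prebundle G M P" and N: "cgh_space N" and F: "continuous_map N M F"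
  shows "prebundle G N (pullback_bundle N F P)"
proof -
  interpret P: prebundle G M P by (rule P)
  let ?T = "subtopology (kprod_topology N (total_space P)) {(x, p). F x = proj P p}"
  have T: "cgh_space ?T"
    using N P.cgh_total P.cgh_base F P.continuous_proj
    by (intro cgh_space_fibre_product) (auto simp: cgh_space_def)
  have fst: "continuous_map ?T N fst" and snd: "continuous_map ?T (total_space P) snd"
    by (rule continuous_map_kprod_fst_sub continuous_map_kprod_snd_sub)+
  have an: "continuous_map ?T (Obj G) (\<lambda>z. anchor P (snd z))"
    using continuous_map_compose[OF snd P.continuous_anchor] by (simp add: o_def)
  show ?thesis
  proof (rule prebundleI[where d = "\<lambda>z w. translation G P (snd z) (snd w)"])
    show "topological_groupoid G" by (rule P.topological_groupoid)
    let ?D = "subtopology (kprod_topology ?T (Arr G)) {(z, g). anchor P (snd z) = tgt G g}"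
    have D: "k_space ?D"
      using k_space_cgh[OF cgh_space_fibre_product[OF T P.cgh_Arr P.Hausdorff_Obj an P.continuous_tgt]] .
    have D1: "continuous_map ?D ?T fst" and D2: "continuous_map ?D (Arr G) snd"
      by (rule continuous_map_kprod_fst_sub continuous_map_kprod_snd_sub)+
    have "continuous_map ?D (total_space P) (\<lambda>z. act P (snd (fst z)) (snd z))"
      using continuous_map_compose[OF D1 snd] D2
      by (intro P.continuous_act[OF D]) (auto simp: o_def)
    moreover have "continuous_map ?D N (\<lambda>z. fst (fst z))"
      using continuous_map_compose[OF D1 fst] by (simp add: o_def)
    ultimately have "continuous_map ?D ?T (\<lambda>z. (fst (fst z), act P (snd (fst z)) (snd z)))"
      by (intro continuous_map_into_subtopology continuous_map_kprod_Pair[OF D]) auto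
    then show "right_space G (total_space (pullback_bundle N F P)) (anchor (pullback_bundle N F P))
        (act (pullback_bundle N F P))"
      unfolding right_space_def using T an
      by (auto simp: P.act_act case_prod_unfold)
    show "admits_local_sections (total_space (pullback_bundle N F P)) N (proj (pullback_bundle N F P))"
      unfolding admits_local_sections_def
    proof
      fix y assume "y \<in> topspace N"
      then obtain W s where W: "openin N W" "y \<in> W"
        and s: "continuous_map (subtopology N W) (total_space P) s" "\<forall>w\<in>W. proj P (s w) = F w"
        using P.local_lift[OF F] by blast
      have "continuous_map (subtopology N W) ?T (\<lambda>w. (w, s w))"
        using s k_space_cgh[OF cgh_space_open_subtopology[OF N W(1)]]
        by (intro continuous_map_into_subtopology continuous_map_kprod_Pair)
           (auto simp: continuous_map_from_subtopology)
      then show "\<exists>U \<sigma>. openin N U \<and> y \<in> U \<and>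
          continuous_map (subtopology N U) (total_space (pullback_bundle N F P)) \<sigma> \<and>
          (\<forall>u\<in>U. proj (pullback_bundle N F P) (\<sigma> u) = u)"
        using W by (intro exI[of _ W] exI[of _ "\<lambda>w. (w, s w)"]) simp
    qed
    let ?F = "subtopology (kprod_topology ?T ?T) {(z, w). fst z = fst w}"
    have Fk: "k_space ?F"
      using N k_space_cgh[OF cgh_space_fibre_product[OF T T _ fst fst]] by (simp add: cgh_space_def)
    have F1: "continuous_map ?F ?T fst" and F2: "continuous_map ?F ?T snd"
      by (rule continuous_map_kprod_fst_sub continuous_map_kprod_snd_sub)+
    have "continuous_map ?F (Arr G) (\<lambda>z. translation G P (snd (fst z)) (snd (snd z)))"
      using continuous_map_compose[OF F1 snd] continuous_map_compose[OF F2 snd]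
      by (intro P.continuous_translation[OF Fk]) (auto simp: o_def)
    then show "continuous_map (subtopology (kprod_topology (total_space (pullback_bundle N F P))
           (total_space (pullback_bundle N F P)))
           {(p, q). proj (pullback_bundle N F P) p = proj (pullback_bundle N F P) q}) (Arr G)
           (\<lambda>(z, w). translation G P (snd z) (snd w))"
      by (simp add: case_prod_unfold)
  qed (use N fst in auto)
qed

lemma pullback_bundle_isomorphic:
  assumes P: "prebundle G M P" and Q: "prebundle G M Q"
    and N: "cgh_space N" and F: "continuous_map N M F" and iso: "bundle_isomorphic G P Q"
  shows "bundle_isomorphic G (pullback_bundle N F P) (pullback_bundle N F Q)"
proof -
  obtain \<phi> where \<phi>: "continuous_map (total_space P) (total_space Q) \<phi>"
    and eq: "\<And>p. p \<in> topspace (total_space P) \<Longrightarrow> \<phi> p \<in> topspace (total_space Q)"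
    "\<And>p. p \<in> topspace (total_space P) \<Longrightarrow> proj Q (\<phi> p) = proj P p"
    "\<And>p. p \<in> topspace (total_space P) \<Longrightarrow> anchor Q (\<phi> p) = anchor P p"
    "\<And>p g. \<lbrakk>p \<in> topspace (total_space P); g \<in> topspace (Arr G); anchor P p = tgt G g\<rbrakk>
          \<Longrightarrow> \<phi> (act P p g) = act Q (\<phi> p) g"
    using bundle_isomorphicE[OF iso] by metis
  show ?thesis
  proof (rule bundle_isomorphicI[OF prebundle_pullback[OF P N F] prebundle_pullback[OF Q N F]])
    have "continuous_map (kprod_topology N (total_space P)) (kprod_topology N (total_space Q))
        (\<lambda>(x, p). (x, \<phi> p))"
      using continuous_map_kprod_map[OF _ \<phi>, of N N "\<lambda>x. x"] by simp
    then show "continuous_map (total_space (pullback_bundle N F P)) (total_space (pullback_bundle N F Q))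
        (\<lambda>(x, p). (x, \<phi> p))"
      by (auto simp: continuous_map_in_subtopology continuous_map_from_subtopology eq)
  qed (auto simp: eq)
qed

text \<open>The isomorphism forgets the middle coordinate, which the pullback condition fixes as
  \<open>F x\<close>.\<close>

lemma pullback_bundle_comp:
  assumes P: "prebundle G B P" and M: "cgh_space M" and f: "continuous_map M B f"
    and N: "cgh_space N" and F: "continuous_map N M F"
  shows "bundle_isomorphic G (pullback_bundle N F (pullback_bundle M f P)) (pullback_bundle N (f \<circ> F) P)"
proof (rule bundle_isomorphicI[OF prebundle_pullback[OF prebundle_pullback[OF P M f] N F]
      prebundle_pullback[OF P N continuous_map_compose[OF F f]]])
  let ?T = "total_space (pullback_bundle N F (pullback_bundle M f P))"
  have T: "k_space ?T"
    using prebundle.cgh_total[OF prebundle_pullback[OF prebundle_pullback[OF P M f] N F]] k_space_cgh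
    by blast
  have "continuous_map ?T (total_space (pullback_bundle M f P)) snd"
    unfolding pullback_bundle_simps(1)[of N] by (rule continuous_map_kprod_snd_sub)
  moreover have "continuous_map (total_space (pullback_bundle M f P)) (total_space P) snd"
    unfolding pullback_bundle_simps(1)[of M] by (rule continuous_map_kprod_snd_sub)
  ultimately have "continuous_map ?T (total_space P) (snd \<circ> snd)" by (rule continuous_map_compose)
  moreover have "continuous_map ?T N fst"
    unfolding pullback_bundle_simps(1)[of N] by (rule continuous_map_kprod_fst_sub)
  ultimately have "continuous_map ?T (kprod_topology N (total_space P)) (\<lambda>z. (fst z, (snd \<circ> snd) z))"
    by (intro continuous_map_kprod_Pair[OF T])
  then show "continuous_map ?T (total_space (pullback_bundle N (f \<circ> F) P)) (\<lambda>z. (fst z, snd (snd z)))"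
    by (auto simp: continuous_map_in_subtopology)
qed auto

subsection \<open>Restriction to the stabilizer\<close>

lemma stabilizer_simps [simp]:
  "Obj (stabilizer G b) = subtopology (Obj G) {b}"
  "Arr (stabilizer G b) = subtopology (Arr G) {g. src G g = b \<and> tgt G g = b}"
  "idt (stabilizer G b) = idt G" "src (stabilizer G b) = src G" "tgt (stabilizer G b) = tgt G"
  "ginv (stabilizer G b) = ginv G" "gcomp (stabilizer G b) = gcomp G"
  by (simp_all add: stabilizer_def)

text \<open>With the stabilizer as a groupoid in its own right, the results on prebundles apply to E
  and to the anchor fibres too.\<close>

lemma (in top_groupoid) topological_groupoid_stabilizer:
  assumes b: "b \<in> topspace (Obj G)"
  shows "topological_groupoid (stabilizer G b)"
proof -
  let ?K = "subtopology (Arr G) {g. src G g = b \<and> tgt G g = b}"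
  have "cgh_space (subtopology (subtopology (Arr G) {g. src G g = b}) {g. tgt G g = b})"
  proof (rule cgh_space_equalizer[where f = "tgt G" and g = "\<lambda>_. b", OF cgh_space_equalizer[where f = "src G" and g = "\<lambda>_. b"]])
    show "continuous_map (subtopology (Arr G) {g. src G g = b}) (Obj G) (tgt G)"
      using continuous_tgt continuous_map_from_subtopology by blast
  qed (use b cgh_Arr Hausdorff_Obj continuous_src in auto)
  then have cK: "cgh_space ?K" by (simp add: subtopology_subtopology Collect_conj_eq)
  have cO: "cgh_space (subtopology (Obj G) {b})"
    by (rule cgh_space_equalizer[where f = "\<lambda>x. x" and g = "\<lambda>_. b"])
       (use b cgh_Obj Hausdorff_Obj in auto)
  have sub: "continuous_map (subtopology (Obj G) {b}) Y f" if "continuous_map (Obj G) Y f" for f and Y :: "'z topology"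
    using that continuous_map_from_subtopology by blast
  have subA: "continuous_map ?K Y f" if "continuous_map (Arr G) Y f" for f and Y :: "'z topology"
    using that continuous_map_from_subtopology by blast
  have cs: "continuous_map ?K (subtopology (Obj G) {b}) (src G)"
    and ct: "continuous_map ?K (subtopology (Obj G) {b}) (tgt G)"
    using subA[OF continuous_src] subA[OF continuous_tgt] by (auto simp: continuous_map_in_subtopology)
  have "k_space (composable (stabilizer G b))"
    using k_space_cgh[OF cgh_space_fibre_product[OF cK cK _ cs ct]] cO
    by (simp add: composable_def cgh_space_def)
  moreover have "continuous_map (composable (stabilizer G b)) (Arr G) fst"
    "continuous_map (composable (stabilizer G b)) (Arr G) snd"
    using continuous_map_kprod_fst_sub[of ?K ?K] continuous_map_kprod_snd_sub[of ?K ?K]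
    unfolding composable_def by (auto simp: continuous_map_in_subtopology)
  ultimately have "continuous_map (composable (stabilizer G b)) (Arr G) (\<lambda>z. gcomp G (fst z) (snd z))"
  proof (intro continuous_gcomp)
    fix z assume "z \<in> topspace (composable (stabilizer G b))"
    then show "src G (fst z) = tgt G (snd z)" by (cases z) (simp add: composable_def)
  qed
  then have "continuous_map (composable (stabilizer G b)) ?K (\<lambda>z. gcomp G (fst z) (snd z))"
  proof (rule continuous_map_into_subtopology, intro Pi_I)
    fix z assume "z \<in> topspace (composable (stabilizer G b))"
    then have "fst z \<in> topspace ?K" "snd z \<in> topspace ?K" by (cases z, simp add: composable_def)+
    then show "gcomp G (fst z) (snd z) \<in> {g. src G g = b \<and> tgt G g = b}" by simp
  qed
  then have comp: "continuous_map (composable (stabilizer G b)) ?K (\<lambda>(g, h). gcomp G g h)"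
    by (simp add: case_prod_unfold)
  \<comment> \<open>Openness of the source is automatic over a single object: the image of a set is
    empty or the whole point.\<close>
  have "open_map ?K (subtopology (Obj G) {b}) (src G)"
    unfolding open_map_def
  proof (intro allI impI)
    fix U assume "openin ?K U"
    then have "U \<subseteq> topspace ?K" by (rule openin_subset)
    then have "src G ` U = {} \<or> src G ` U = {b}" by auto
    moreover have "openin (subtopology (Obj G) {b}) {b}"
      using openin_topspace[of "subtopology (Obj G) {b}"] b by simp
    ultimately show "openin (subtopology (Obj G) {b}) (src G ` U)" by auto
  qed
  then show ?thesis
    unfolding topological_groupoid_def
    using cK cO cs ct comp subA[OF continuous_ginv] sub[OF continuous_idt]
    by (auto simp: continuous_map_in_subtopology gcomp_assoc)
qed

text \<open>The space \<open>P_b\<close>. The action keeps its formula for all arrows of G; those of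
  the stabilizer are the ones that map the subspace to itself.\<close>

definition anchor_fibre :: "'o \<Rightarrow> ('p, 'm, 'o, 'g) gbundle \<Rightarrow> ('p, 'm, 'o, 'g) gbundle" where
  "anchor_fibre b P = P\<lparr>total_space := subtopology (total_space P) {p. anchor P p = b}\<rparr>"

lemma anchor_fibre_simps [simp]:
  "total_space (anchor_fibre b P) = subtopology (total_space P) {p. anchor P p = b}"
  "proj (anchor_fibre b P) = proj P" "anchor (anchor_fibre b P) = anchor P"
  "act (anchor_fibre b P) = act P"
  by (simp_all add: anchor_fibre_def)

text \<open>Between two points anchored at b the translation of P has source and target b, so it is
  also the division map for the stabilizer.\<close>

lemma prebundle_anchor_fibre:
  assumes P: "prebundle G M P" and b: "b \<in> topspace (Obj G)"
    and ls: "admits_local_sections (arrows_from G b) (Obj G) (tgt G)"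
  shows "prebundle (stabilizer G b) M (anchor_fibre b P)"
proof -
  interpret P: prebundle G M P by (rule P)
  let ?X = "subtopology (total_space P) {p. anchor P p = b}"
  let ?K = "subtopology (Arr G) {g. src G g = b \<and> tgt G g = b}"
  interpret K: top_groupoid "stabilizer G b"
    by unfold_locales (rule P.topological_groupoid_stabilizer[OF b])
  have cK: "cgh_space ?K" using K.cgh_Arr by simp
  have X: "cgh_space ?X"
    by (rule cgh_space_equalizer[where f = "anchor P" and g = "\<lambda>_. b"])
       (use b P.cgh_total P.Hausdorff_Obj P.continuous_anchor in auto)
  have XP: "continuous_map ?X (total_space P) (\<lambda>x. x)" by (simp add: continuous_map_from_subtopology)
  have KA: "continuous_map ?K (Arr G) (\<lambda>x. x)" by (simp add: continuous_map_from_subtopology)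
  have an: "continuous_map ?X (Obj G) (anchor P)" and pr: "continuous_map ?X M (proj P)"
    using P.continuous_anchor P.continuous_proj continuous_map_from_subtopology by blast+
  have tK: "continuous_map ?K (Obj G) (tgt G)"
    using P.continuous_tgt continuous_map_from_subtopology by blast
  show ?thesis
  proof (rule prebundleI[where d = "translation G P"])
    show "topological_groupoid (stabilizer G b)" by (rule K.topological_groupoid)
    let ?D = "subtopology (kprod_topology ?X ?K) {(z, g). anchor P z = tgt G g}"
    have D: "k_space ?D"
      using k_space_cgh[OF cgh_space_fibre_product[OF X cK P.Hausdorff_Obj an tK]] .
    have D1: "continuous_map ?D (total_space P) fst" and D2: "continuous_map ?D (Arr G) snd"
      using continuous_map_compose[OF continuous_map_kprod_fst_sub XP]
        continuous_map_compose[OF continuous_map_kprod_snd_sub KA] by (auto simp: o_def)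
    have "continuous_map ?D (total_space P) (\<lambda>z. act P (fst z) (snd z))"
      by (rule P.continuous_act[OF D D1 D2]) auto
    then have "continuous_map ?D ?X (\<lambda>z. act P (fst z) (snd z))"
    proof (rule continuous_map_into_subtopology, intro Pi_I CollectI)
      fix z assume "z \<in> topspace ?D"
      then have "fst z \<in> topspace (total_space P)" "snd z \<in> topspace (Arr G)"
        "anchor P (fst z) = tgt G (snd z)" "src G (snd z) = b" by auto
      then show "anchor P (act P (fst z) (snd z)) = b" using P.anchor_act by metis
    qed
    then show "right_space (stabilizer G b) (total_space (anchor_fibre b P)) (anchor (anchor_fibre b P))
        (act (anchor_fibre b P))"
      unfolding right_space_def using X an
      by (auto simp: P.act_act case_prod_unfold continuous_map_in_subtopology)
    show "admits_local_sections (total_space (anchor_fibre b P)) M (proj (anchor_fibre b P))"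
      unfolding admits_local_sections_def
    proof
      fix y assume y: "y \<in> topspace M"
      then obtain W s where W: "openin M W" "y \<in> W"
        and s: "continuous_map (subtopology M W) (total_space P) s" "\<forall>w\<in>W. proj P (s w) = w"
        using P.local_lift[OF continuous_map_id] unfolding id_def by blast
      have tW: "topspace (subtopology M W) = W" using W(1) openin_subset by auto
      have sin: "s w \<in> topspace (total_space P)" if "w \<in> W" for w
        using continuous_map_into_topspace[OF s(1), unfolded tW, OF that] .
      have as: "continuous_map (subtopology M W) (Obj G) (\<lambda>w. anchor P (s w))"
        using continuous_map_compose[OF s(1) P.continuous_anchor] by (simp add: o_def)
      obtain V \<tau> where V: "openin (Obj G) V" "anchor P (s y) \<in> V"
        and \<tau>: "continuous_map (subtopology (Obj G) V) (arrows_from G b) \<tau>" "\<forall>u\<in>V. tgt G (\<tau> u) = u"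
        using ls sin[OF W(2)] unfolding admits_local_sections_def by (meson P.anchor_in)
      have tV: "topspace (subtopology (Obj G) V) = V" using V(1) openin_subset by auto
      have \<tau>in: "\<tau> u \<in> topspace (Arr G)" "src G (\<tau> u) = b" if "u \<in> V" for u
        using continuous_map_into_topspace[OF \<tau>(1), unfolded tV, OF that] by (auto simp: arrows_from_def)
      \<comment> \<open>On this smaller set the anchors along s stay where the section
        \<open>\<tau>\<close> of the target map is defined.\<close>
      define W' where "W' = {w \<in> W. anchor P (s w) \<in> V}"
      have "openin (subtopology M W) W'"
        using openin_continuous_map_preimage[OF as V(1)] unfolding tW W'_def .
      then have W': "openin M W'" using W(1) openin_trans_full by blast
      have "y \<in> W'" using W(2) V(2) by (simp add: W'_def)
      have Z: "k_space (subtopology M W')"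
        using k_space_cgh[OF cgh_space_open_subtopology[OF P.cgh_base W']] .
      have sub: "W' \<subseteq> W" by (auto simp: W'_def)
      have s': "continuous_map (subtopology M W') (total_space P) s"
        using continuous_map_from_subtopology_mono[OF s(1) sub] .
      have "continuous_map (subtopology M W') (subtopology (Obj G) V) (\<lambda>w. anchor P (s w))"
        using continuous_map_from_subtopology_mono[OF as sub]
        by (auto simp: continuous_map_in_subtopology W'_def)
      from continuous_map_compose[OF this \<tau>(1)]
      have "continuous_map (subtopology M W') (Arr G) (\<lambda>w. \<tau> (anchor P (s w)))"
        by (auto simp: arrows_from_def continuous_map_in_subtopology o_def)
      \<comment> \<open>The arrow \<open>\<tau> (anchor P (s w))\<close> ends at the anchor of
        \<open>s w\<close> and starts at b, so acting by it moves \<open>s w\<close> within its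
        fibre to a point anchored at b.\<close>
      then have "continuous_map (subtopology M W') (total_space P) (\<lambda>w. act P (s w) (\<tau> (anchor P (s w))))"
        using \<tau>(2) by (intro P.continuous_act[OF Z s']) (auto simp: W'_def)
      then have "continuous_map (subtopology M W') ?X (\<lambda>w. act P (s w) (\<tau> (anchor P (s w))))"
        using \<tau>in \<tau>(2) sin by (auto simp: continuous_map_in_subtopology W'_def)
      moreover have "\<forall>w\<in>W'. proj P (act P (s w) (\<tau> (anchor P (s w)))) = w"
        using \<tau>in \<tau>(2) sin s(2) by (auto simp: W'_def)
      ultimately show "\<exists>U \<sigma>. openin M U \<and> y \<in> U \<and>
          continuous_map (subtopology M U) (total_space (anchor_fibre b P)) \<sigma> \<and>
          (\<forall>u\<in>U. proj (anchor_fibre b P) (\<sigma> u) = u)"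
        unfolding anchor_fibre_simps using W' \<open>y \<in> W'\<close> by blast
    qed
    let ?F = "subtopology (kprod_topology ?X ?X) {(z, w). proj P z = proj P w}"
    have Fk: "k_space ?F"
      using P.cgh_base k_space_cgh[OF cgh_space_fibre_product[OF X X _ pr pr]] by (simp add: cgh_space_def)
    have F1: "continuous_map ?F (total_space P) fst" and F2: "continuous_map ?F (total_space P) snd"
      using continuous_map_compose[OF continuous_map_kprod_fst_sub XP]
        continuous_map_compose[OF continuous_map_kprod_snd_sub XP] by (auto simp: o_def)
    have "continuous_map ?F (Arr G) (\<lambda>z. translation G P (fst z) (snd z))"
      by (rule P.continuous_translation[OF Fk F1 F2]) auto
    then show "continuous_map (subtopology (kprod_topology (total_space (anchor_fibre b P))
           (total_space (anchor_fibre b P)))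
           {(p, q). proj (anchor_fibre b P) p = proj (anchor_fibre b P) q}) (Arr (stabilizer G b))
           (\<lambda>(z, w). translation G P z w)"
      by (auto simp add: case_prod_unfold continuous_map_in_subtopology)
  qed (use P.cgh_base pr in auto)
qed

text \<open>Since \<open>P_b\<close> has points over all of M, every p is q g with q in
  \<open>P_b\<close> over the same base point, which forces p \<mapsto> \<phi> q g. Another choice
  of q differs by a stabilizer element, and \<open>\<phi>\<close> respects these.\<close>

lemma anchor_fibre_isomorphic_iff:
  assumes P: "prebundle G M P" and Q: "prebundle G M Q" and b: "b \<in> topspace (Obj G)"
    and ls: "admits_local_sections (arrows_from G b) (Obj G) (tgt G)"
  shows "bundle_isomorphic (stabilizer G b) (anchor_fibre b P) (anchor_fibre b Q) \<longleftrightarrow>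
    bundle_isomorphic G P Q"
proof
  interpret P: prebundle G M P by (rule P)
  interpret Q: prebundle G M Q by (rule Q)
  interpret Pb: prebundle "stabilizer G b" M "anchor_fibre b P" by (rule prebundle_anchor_fibre[OF P b ls])
  let ?X = "total_space P" and ?Y = "total_space Q"
  let ?Xb = "subtopology ?X {p. anchor P p = b}"
  {
    assume "bundle_isomorphic G P Q"
    then obtain \<phi> where \<phi>: "continuous_map ?X ?Y \<phi>"
      and eq: "\<And>p. p \<in> topspace ?X \<Longrightarrow> \<phi> p \<in> topspace ?Y"
      "\<And>p. p \<in> topspace ?X \<Longrightarrow> proj Q (\<phi> p) = proj P p"
      "\<And>p. p \<in> topspace ?X \<Longrightarrow> anchor Q (\<phi> p) = anchor P p"
      "\<And>p g. \<lbrakk>p \<in> topspace ?X; g \<in> topspace (Arr G); anchor P p = tgt G g\<rbrakk>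
          \<Longrightarrow> \<phi> (act P p g) = act Q (\<phi> p) g"
      using bundle_isomorphicE by metis
    show "bundle_isomorphic (stabilizer G b) (anchor_fibre b P) (anchor_fibre b Q)"
      by (rule bundle_isomorphicI[where \<phi> = \<phi>, OF prebundle_anchor_fibre[OF P b ls] prebundle_anchor_fibre[OF Q b ls]])
         (use \<phi> in \<open>auto simp: eq continuous_map_in_subtopology continuous_map_from_subtopology\<close>)
  }
  assume "bundle_isomorphic (stabilizer G b) (anchor_fibre b P) (anchor_fibre b Q)"
  then obtain \<phi> where \<phi>: "continuous_map ?Xb (subtopology ?Y {p. anchor Q p = b}) \<phi>"
    and pr: "\<And>p. p \<in> topspace ?X \<Longrightarrow> anchor P p = b \<Longrightarrow> proj Q (\<phi> p) = proj P p"
    and ac: "\<And>p g. \<lbrakk>p \<in> topspace ?X; anchor P p = b; g \<in> topspace (Arr G); tgt G g = b; src G g = b\<rbrakk>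
          \<Longrightarrow> \<phi> (act P p g) = act Q (\<phi> p) g"
    by (elim bundle_isomorphicE) auto
  have \<phi>Y: "continuous_map ?Xb ?Y \<phi>" using \<phi> by (simp add: continuous_map_in_subtopology)
  have \<phi>in: "\<phi> p \<in> topspace ?Y" "anchor Q (\<phi> p) = b" if "p \<in> topspace ?X" "anchor P p = b" for p
    using continuous_map_into_topspace[OF \<phi>] that by auto
  \<comment> \<open>An arbitrary, possibly discontinuous choice of reference points. The fact
    \<open>\<Phi>\<close> below frees the definition from it, so that continuity can be tested on
    local sections of \<open>P_b\<close>.\<close>
  define r where "r p = (SOME q. q \<in> topspace ?X \<and> anchor P q = b \<and> proj P q = proj P p)" for p
  define \<Phi> where "\<Phi> p = act Q (\<phi> (r p)) (translation G P (r p) p)" for p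
  have r: "r p \<in> topspace ?X" "anchor P (r p) = b" "proj P (r p) = proj P p" if "p \<in> topspace ?X" for p
  proof -
    have "\<exists>q. q \<in> topspace ?X \<and> anchor P q = b \<and> proj P q = proj P p"
      using Pb.proj_surj[of "proj P p"] that by auto
    from someI_ex[OF this] show "r p \<in> topspace ?X" "anchor P (r p) = b" "proj P (r p) = proj P p"
      unfolding r_def by auto
  qed
  \<comment> \<open>The choice depends on the base point only, so p and p g share their reference
    point.\<close>
  have r_act: "r (act P p g) = r p" if "p \<in> topspace ?X" "g \<in> topspace (Arr G)" "anchor P p = tgt G g" for p g
    using that by (simp add: r_def)
  have \<Phi>: "\<Phi> p = act Q (\<phi> q) (translation G P q p)"
    if p: "p \<in> topspace ?X" and q: "q \<in> topspace ?X" "anchor P q = b" "proj P q = proj P p" for p q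
  proof -
    \<comment> \<open>Both ends of \<open>?k\<close> are anchored at b, so it lies in the stabilizer
      and \<open>ac\<close> lets it pass through \<open>\<phi>\<close>.\<close>
    let ?k = "translation G P q (r p)"
    have "act Q (\<phi> q) (translation G P q p) = act Q (\<phi> q) (gcomp G ?k (translation G P (r p) p))"
      using P.translation_trans[of q "r p" p] p q r[OF p] by simp
    also have "\<dots> = act Q (act Q (\<phi> q) ?k) (translation G P (r p) p)"
      using p q r[OF p] \<phi>in by (subst Q.act_act) auto
    also have "act Q (\<phi> q) ?k = \<phi> (act P q ?k)"
      using q r[OF p] by (subst ac) auto
    finally show ?thesis using q r[OF p] by (simp add: \<Phi>_def)
  qed
  show "bundle_isomorphic G P Q"
  proof (rule bundle_isomorphicI[where \<phi> = \<Phi>, OF P Q])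
    show "continuous_map ?X ?Y \<Phi>"
    proof (rule Pb.continuous_map_by_lifts[OF P.cgh_total P.continuous_proj])
      fix W s
      let ?W = "subtopology ?X W"
      assume W: "topspace ?W = W" "k_space ?W"
        and s: "continuous_map ?W (total_space (anchor_fibre b P)) s"
        and wX: "\<And>w. w \<in> W \<Longrightarrow> w \<in> topspace ?X"
        and "\<And>w. w \<in> W \<Longrightarrow> s w \<in> topspace (total_space (anchor_fibre b P))"
        and "\<And>w. w \<in> W \<Longrightarrow> proj (anchor_fibre b P) (s w) = proj P w"
      then have sX: "\<And>w. w \<in> W \<Longrightarrow> s w \<in> topspace ?X" and sb: "\<And>w. w \<in> W \<Longrightarrow> anchor P (s w) = b"
        and ps: "\<And>w. w \<in> W \<Longrightarrow> proj P (s w) = proj P w" by auto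
      have sXb: "continuous_map ?W ?Xb s" using s by simp
      have "continuous_map ?W ?X s" using sXb by (simp add: continuous_map_in_subtopology)
      moreover have "continuous_map ?W ?X (\<lambda>w. w)" by (simp add: continuous_map_from_subtopology)
      ultimately have "continuous_map ?W (Arr G) (\<lambda>w. translation G P (s w) w)"
        by (rule P.continuous_translation[OF W(2)]) (simp only: W(1) ps)
      moreover have "continuous_map ?W ?Y (\<lambda>w. \<phi> (s w))"
        using continuous_map_compose[OF sXb \<phi>Y] by (simp add: o_def)
      ultimately have "continuous_map ?W ?Y (\<lambda>w. act Q (\<phi> (s w)) (translation G P (s w) w))"
        by (intro Q.continuous_act[OF W(2)])
           (simp_all only: W(1) P.tgt_translation sX sb ps wX \<phi>in)
      then show "continuous_map ?W ?Y \<Phi>"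
        by (rule continuous_map_eq) (metis W(1) \<Phi> sX sb ps wX)
    qed
    fix p assume p: "p \<in> topspace ?X"
    show "proj Q (\<Phi> p) = proj P p" "anchor Q (\<Phi> p) = anchor P p"
      using p r[OF p] \<phi>in pr by (simp_all add: \<Phi>_def)
    fix g assume g: "g \<in> topspace (Arr G)" "anchor P p = tgt G g"
    show "\<Phi> (act P p g) = act Q (\<Phi> p) g"
      using p g r[OF p] \<phi>in by (simp add: \<Phi>_def r_act P.translation_act_right Q.act_act)
  qed
qed

section \<open>The associated bundle\<close>

context top_groupoid
begin

lemma gcomp_ginv_cancel [simp]:
  assumes "g \<in> topspace (Arr G)" "h \<in> topspace (Arr G)"
  shows "tgt G g = tgt G h \<Longrightarrow> gcomp G g (gcomp G (ginv G g) h) = h"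
    and "src G g = tgt G h \<Longrightarrow> gcomp G (ginv G g) (gcomp G g h) = h"
  using assms by (simp_all flip: gcomp_assoc)

lemma ginv_unique:
  assumes "g \<in> topspace (Arr G)" "h \<in> topspace (Arr G)" "src G g = tgt G h"
    and "gcomp G g h = idt G (tgt G g)"
  shows "h = ginv G g"
  using gcomp_ginv_cancel(2)[of g h] assms by simp

lemma ginv_ginv [simp]: "g \<in> topspace (Arr G) \<Longrightarrow> ginv G (ginv G g) = g"
  by (rule ginv_unique[symmetric]) simp_all

lemma ginv_gcomp:
  assumes "g \<in> topspace (Arr G)" "h \<in> topspace (Arr G)" "src G g = tgt G h"
  shows "ginv G (gcomp G g h) = gcomp G (ginv G h) (ginv G g)"
  by (rule ginv_unique[symmetric]) (use assms in \<open>simp_all add: gcomp_assoc\<close>)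

end

locale stabilizer_bundle = top_groupoid G for G :: "('o, 'g) groupoid" +
  fixes b :: 'o and B :: "'b topology" and E :: "('e, 'b, 'o, 'g) gbundle"
  assumes base_point: "b \<in> topspace (Obj G)"
    and prebundle_E: "prebundle (stabilizer G b) B E"
begin

interpretation E: prebundle "stabilizer G b" B E by (rule prebundle_E)

abbreviation EG where "EG \<equiv> associated_bundle G b E"
abbreviation orb where "orb \<equiv> antidiagonal_orbit G b E"
abbreviation pairs where "pairs \<equiv> kprod_topology (total_space E) (arrows_into G b)"

section \<open>Algebra of the antidiagonal orbits\<close>

lemma anchor_E [simp]: "z \<in> topspace (total_space E) \<Longrightarrow> anchor E z = b"
  using E.anchor_in[of z] by simp

lemma topspace_arrows_into [simp]:
  "topspace (arrows_into G b) = {f \<in> topspace (Arr G). tgt G f = b}"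
  by (auto simp: arrows_into_def)

lemma act_E_idt [simp]: "z \<in> topspace (total_space E) \<Longrightarrow> act E z (idt G b) = z"
  using E.act_idt[of z b] by simp

lemma act_E:
  assumes "z \<in> topspace (total_space E)" "k \<in> topspace (Arr G)" "tgt G k = b" "src G k = b"
  shows act_E_in [simp]: "act E z k \<in> topspace (total_space E)"
    and proj_act_E [simp]: "proj E (act E z k) = proj E z"
  using assms by simp_all

lemma act_act_E:
  assumes "z \<in> topspace (total_space E)" "k \<in> topspace (Arr G)" "tgt G k = b" "src G k = b"
    "l \<in> topspace (Arr G)" "tgt G l = b" "src G l = b"
  shows "act E (act E z k) l = act E z (gcomp G k l)"
  using E.act_act[of z k l] assms by simp

lemma orb_def:
  "orb (z, f) = {(act E z (ginv G k), gcomp G k f) | k.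
     k \<in> topspace (Arr G) \<and> src G k = b \<and> tgt G k = b}"
  by (simp add: antidiagonal_orbit_def)

lemma orb_self:
  assumes "(z, f) \<in> topspace pairs" shows "(z, f) \<in> orb (z, f)"
proof -
  have "ginv G (idt G b) = idt G b"
    by (rule ginv_unique[symmetric]) (use base_point in simp_all)
  then show ?thesis using assms base_point unfolding orb_def
    by (intro CollectI exI[of _ "idt G b"]) simp
qed

lemma orb_act_subset:
  assumes "z \<in> topspace (total_space E)" "f \<in> topspace (Arr G)" "tgt G f = b"
    and "k \<in> topspace (Arr G)" "tgt G k = b" "src G k = b"
  shows "orb (act E z k, f) \<subseteq> orb (z, gcomp G k f)"
proof
  fix x assume "x \<in> orb (act E z k, f)"
  then obtain h where h: "h \<in> topspace (Arr G)" "src G h = b" "tgt G h = b"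
    and x: "x = (act E (act E z k) (ginv G h), gcomp G h f)"
    unfolding orb_def by auto
  \<comment> \<open>With this arrow h = ?h k and k h^-1 = ?h^-1, so the element that h contributes
    to the first orbit is the one that ?h contributes to the second.\<close>
  let ?h = "gcomp G h (ginv G k)"
  have "x = (act E z (ginv G ?h), gcomp G ?h (gcomp G k f))"
    using assms h by (simp add: x act_act_E ginv_gcomp gcomp_assoc)
  then show "x \<in> orb (z, gcomp G k f)"
    using assms h unfolding orb_def by (intro CollectI exI[of _ ?h]) simp
qed

text \<open>The defining relation [z k, f] = [z, k f]. The inclusion not yet shown is the previous
  lemma for the inverse of k.\<close>

lemma orb_act:
  assumes "z \<in> topspace (total_space E)" "f \<in> topspace (Arr G)" "tgt G f = b"
    and "k \<in> topspace (Arr G)" "tgt G k = b" "src G k = b"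
  shows "orb (act E z k, f) = orb (z, gcomp G k f)"
proof
  show "orb (act E z k, f) \<subseteq> orb (z, gcomp G k f)" by (rule orb_act_subset[OF assms])
  have "act E (act E z k) (ginv G k) = z"
    using assms by (simp add: act_act_E)
  then show "orb (z, gcomp G k f) \<subseteq> orb (act E z k, f)"
    using orb_act_subset[of "act E z k" "gcomp G k f" "ginv G k"] assms by simp
qed

text \<open>An element k that relates the two pairs fixes s, hence it is the unit, as the stabilizer
  acts freely on E. With \<open>orb_coordinates\<close> this parametrises the fibre of
  \<open>EG\<close> over \<open>proj E s\<close> by the arrows into b.\<close>

lemma orb_inj:
  assumes s: "s \<in> topspace (total_space E)" and f: "f \<in> topspace (Arr G)" "tgt G f = b"
    and f': "f' \<in> topspace (Arr G)" "tgt G f' = b" and eq: "orb (s, f) = orb (s, f')"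
  shows "f = f'"
proof -
  have "(s, f) \<in> orb (s, f')" using orb_self[of s f] s f eq by simp
  then obtain k where k: "k \<in> topspace (Arr G)" "src G k = b" "tgt G k = b"
    and "s = act E s (ginv G k)" "f = gcomp G k f'"
    unfolding orb_def by auto
  then have "act E s (idt G b) = act E s (ginv G k)" using s by simp
  then have "idt G b = ginv G k"
    using s k base_point by (intro E.act_inj[of s]) auto
  then have "ginv G k = idt G b" "ginv G (ginv G k) = k" using k by auto
  moreover have "ginv G (idt G b) = idt G b"
    by (rule ginv_unique[symmetric]) (use base_point in simp_all)
  ultimately have "k = idt G b" by simp
  then show ?thesis using \<open>f = gcomp G k f'\<close> f' by simp
qed

text \<open>Write z = s t with t in the stabilizer and move t to the other factor.\<close>

lemma orb_coordinates:
  assumes "s \<in> topspace (total_space E)" "(z, f) \<in> topspace pairs" "proj E s = proj E z"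
  shows "orb (z, f) = orb (s, gcomp G (translation (stabilizer G b) E s z) f)"
proof -
  let ?t = "translation (stabilizer G b) E s z"
  have "act E s ?t = z" "?t \<in> topspace (Arr (stabilizer G b))"
    using E.translation[of s z] assms by simp_all
  with orb_act[of s f ?t] assms show ?thesis by simp
qed

lemma translation_E:
  assumes "s \<in> topspace (total_space E)" "z \<in> topspace (total_space E)" "proj E s = proj E z"
  shows "translation (stabilizer G b) E s z \<in> topspace (Arr G)"
    "src G (translation (stabilizer G b) E s z) = b" "tgt G (translation (stabilizer G b) E s z) = b"
  using E.translation_in[OF assms] by simp_all

lemma total_EG: "total_space EG = quotient_topology pairs orb"
  by (simp add: associated_bundle_def)

lemma quotient_map_orb: "quotient_map pairs (total_space EG) orb"
  unfolding total_EG by (rule quotient_map_quotient_topology)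

lemma continuous_orb: "continuous_map pairs (total_space EG) orb"
  using quotient_map_orb quotient_imp_continuous_map by blast

lemma topspace_EG: "topspace (total_space EG) = orb ` topspace pairs"
  by (simp only: total_EG topspace_quotient_topology)

lemma EG_cases:
  assumes "c \<in> topspace (total_space EG)"
  obtains z f where "c = orb (z, f)" "z \<in> topspace (total_space E)" "f \<in> topspace (Arr G)" "tgt G f = b"
  using assms by (auto simp: topspace_EG)

lemma proj_orb:
  assumes "z \<in> topspace (total_space E)" "f \<in> topspace (Arr G)" "tgt G f = b"
  shows "proj EG (orb (z, f)) = proj E z"
proof -
  have "(\<lambda>(z, f). proj E z) ` orb (z, f) = {proj E z}"
  proof (rule antisym)
    show "(\<lambda>(z, f). proj E z) ` orb (z, f) \<subseteq> {proj E z}"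
      using assms by (auto simp: orb_def)
    show "{proj E z} \<subseteq> (\<lambda>(z, f). proj E z) ` orb (z, f)"
      using imageI[OF orb_self[of z f], of "\<lambda>(z, f). proj E z"] assms by simp
  qed
  then show ?thesis by (simp add: associated_bundle_def)
qed

lemma anchor_orb:
  assumes "z \<in> topspace (total_space E)" "f \<in> topspace (Arr G)" "tgt G f = b"
  shows "anchor EG (orb (z, f)) = src G f"
proof -
  have "(\<lambda>(z, f). src G f) ` orb (z, f) = {src G f}"
  proof (rule antisym)
    show "(\<lambda>(z, f). src G f) ` orb (z, f) \<subseteq> {src G f}"
      using assms by (auto simp: orb_def)
    show "{src G f} \<subseteq> (\<lambda>(z, f). src G f) ` orb (z, f)"
      using imageI[OF orb_self[of z f], of "\<lambda>(z, f). src G f"] assms by simp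
  qed
  then show ?thesis by (simp add: associated_bundle_def)
qed

text \<open>Composition with k on the left commutes with composition with g on the right, so acting
  elementwise on an orbit gives an orbit.\<close>

lemma act_orb:
  assumes "z \<in> topspace (total_space E)" "f \<in> topspace (Arr G)" "tgt G f = b"
    and "g \<in> topspace (Arr G)" "src G f = tgt G g"
  shows "act EG (orb (z, f)) g = orb (z, gcomp G f g)"
proof -
  have "(\<lambda>(z, f). (z, gcomp G f g)) ` orb (z, f) =
      (\<lambda>k. (act E z (ginv G k), gcomp G (gcomp G k f) g)) `
        {k. k \<in> topspace (Arr G) \<and> src G k = b \<and> tgt G k = b}"
    by (auto simp: orb_def image_iff)
  also have "\<dots> = (\<lambda>k. (act E z (ginv G k), gcomp G k (gcomp G f g))) `
        {k. k \<in> topspace (Arr G) \<and> src G k = b \<and> tgt G k = b}"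
    using assms by (intro image_cong) (auto simp: gcomp_assoc)
  also have "\<dots> = orb (z, gcomp G f g)" by (auto simp: orb_def)
  finally show ?thesis by (simp add: associated_bundle_def)
qed

section \<open>Topology of the associated bundle\<close>

lemma cgh_arrows_into: "cgh_space (arrows_into G b)"
  unfolding arrows_into_def
  by (rule cgh_space_equalizer[where f = "tgt G" and g = "\<lambda>_. b"])
     (use base_point cgh_Arr Hausdorff_Obj continuous_tgt in auto)

lemma cgh_pairs: "cgh_space pairs"
  by (rule cgh_space_kprod[OF E.cgh_total cgh_arrows_into])

lemma continuous_pairs:
  "continuous_map pairs (total_space E) fst" "continuous_map pairs (Arr G) snd"
  using continuous_map_kprod_fst[of "total_space E" "arrows_into G b"]
    continuous_map_kprod_snd[of "total_space E" "arrows_into G b"]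
  by (auto simp: arrows_into_def continuous_map_in_subtopology)

lemma continuous_map_orb:
  assumes "k_space Z" "continuous_map Z (total_space E) s" "continuous_map Z (Arr G) f"
    and "\<And>z. z \<in> topspace Z \<Longrightarrow> tgt G (f z) = b"
  shows "continuous_map Z (total_space EG) (\<lambda>z. orb (s z, f z))"
proof -
  have "continuous_map Z pairs (\<lambda>z. (s z, f z))"
    using assms by (intro continuous_map_kprod_Pair)
      (auto simp: arrows_into_def continuous_map_in_subtopology)
  from continuous_map_compose[OF this continuous_orb] show ?thesis by (simp add: o_def)
qed

lemma continuous_proj_EG: "continuous_map (total_space EG) B (proj EG)"
proof (rule continuous_compose_quotient_map[OF quotient_map_orb])
  have "continuous_map pairs B (proj E \<circ> fst)"
    using continuous_map_compose[OF continuous_pairs(1) E.continuous_proj] .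
  then show "continuous_map pairs B (proj EG \<circ> orb)"
  proof (rule continuous_map_eq)
    fix x assume "x \<in> topspace pairs"
    then show "(proj E \<circ> fst) x = (proj EG \<circ> orb) x" by (cases x) (simp add: proj_orb)
  qed
qed

lemma continuous_anchor_EG: "continuous_map (total_space EG) (Obj G) (anchor EG)"
proof (rule continuous_compose_quotient_map[OF quotient_map_orb])
  have "continuous_map pairs (Obj G) (src G \<circ> snd)"
    using continuous_map_compose[OF continuous_pairs(2) continuous_src] .
  then show "continuous_map pairs (Obj G) (anchor EG \<circ> orb)"
  proof (rule continuous_map_eq)
    fix x assume "x \<in> topspace pairs"
    then show "(src G \<circ> snd) x = (anchor EG \<circ> orb) x" by (cases x) (simp add: anchor_orb)
  qed
qed

text \<open>A local section of \<open>E\<close> over \<open>U\<close> trivialises \<open>E\<G>\<close> over \<open>U\<close> with fibre \<open>\<G>\<^sup>b\<close>.\<close>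

lemma local_coordinates:
  assumes m: "m \<in> topspace B"
  obtains U \<sigma> \<kappa> where "openin B U" "m \<in> U" "continuous_map (subtopology B U) (total_space E) \<sigma>"
    and "continuous_map (subtopology (total_space EG) {c \<in> topspace (total_space EG). proj EG c \<in> U}) (Arr G) \<kappa>"
    and "\<forall>u\<in>U. \<sigma> u \<in> topspace (total_space E)" "\<forall>u\<in>U. proj E (\<sigma> u) = u"
    and "\<forall>c\<in>topspace (total_space EG). proj EG c \<in> U \<longrightarrow>
      \<kappa> c \<in> topspace (Arr G) \<and> tgt G (\<kappa> c) = b \<and> c = orb (\<sigma> (proj EG c), \<kappa> c)"
proof -
  let ?X = "total_space EG"
  obtain U \<sigma> where U: "openin B U" "m \<in> U"
    and \<sigma>0: "continuous_map (subtopology B U) (total_space E) \<sigma>" "\<forall>u\<in>U. proj E (\<sigma> u) = u"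
    using E.local_sections m unfolding admits_local_sections_def by blast
  then have \<sigma>: "continuous_map (subtopology B U) (total_space E) \<sigma>" "\<And>u. u \<in> U \<Longrightarrow> proj E (\<sigma> u) = u"
    by blast+
  have tU: "topspace (subtopology B U) = U" using U(1) openin_subset by auto
  have \<sigma>in: "\<sigma> u \<in> topspace (total_space E)" if "u \<in> U" for u
    using continuous_map_into_topspace[OF \<sigma>(1), unfolded tU, OF that] .
  let ?W = "{c \<in> topspace ?X. proj EG c \<in> U}"
  \<comment> \<open>The fibre coordinate of c relative to the section;
    \<open>orb_coordinates\<close> provides it and \<open>orb_inj\<close> makes it unique.\<close>
  define \<kappa> where "\<kappa> c = (THE f. f \<in> topspace (Arr G) \<and> tgt G f = b \<and> c = orb (\<sigma> (proj EG c), f))" for c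
  have \<kappa>: "\<kappa> (orb (z, f)) = gcomp G (translation (stabilizer G b) E (\<sigma> (proj E z)) z) f \<and>
      \<kappa> (orb (z, f)) \<in> topspace (Arr G) \<and> tgt G (\<kappa> (orb (z, f))) = b \<and>
      orb (z, f) = orb (\<sigma> (proj E z), \<kappa> (orb (z, f)))"
    if z: "z \<in> topspace (total_space E)" "f \<in> topspace (Arr G)" "tgt G f = b" "proj E z \<in> U" for z f
  proof -
    let ?s = "\<sigma> (proj E z)" and ?t = "translation (stabilizer G b) E (\<sigma> (proj E z)) z"
    have t: "?t \<in> topspace (Arr G)" "src G ?t = b" "tgt G ?t = b"
      using translation_E[of ?s z] \<sigma>in \<sigma>(2) z by simp_all
    have o: "orb (z, f) = orb (?s, gcomp G ?t f)"
      using orb_coordinates[of ?s z f] \<sigma>in \<sigma>(2) z by simp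
    have "\<kappa> (orb (z, f)) = gcomp G ?t f"
      unfolding \<kappa>_def proj_orb[OF z(1-3)]
    proof (rule the_equality)
      show "gcomp G ?t f \<in> topspace (Arr G) \<and> tgt G (gcomp G ?t f) = b \<and>
          orb (z, f) = orb (?s, gcomp G ?t f)" using t z o by simp
      fix f' assume f': "f' \<in> topspace (Arr G) \<and> tgt G f' = b \<and> orb (z, f) = orb (?s, f')"
      have "gcomp G ?t f \<in> topspace (Arr G)" "tgt G (gcomp G ?t f) = b" using t z by simp_all
      moreover have "orb (?s, f') = orb (?s, gcomp G ?t f)" using f' o by metis
      ultimately show "f' = gcomp G ?t f" using orb_inj[OF \<sigma>in[OF z(4)]] f' by blast
    qed
    with t z o show ?thesis by simp
  qed
  have W: "openin ?X ?W" using continuous_proj_EG U(1) openin_continuous_map_preimage by blast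
  let ?V = "{x \<in> topspace pairs. orb x \<in> ?W}"
  have V: "openin pairs ?V" using continuous_orb W openin_continuous_map_preimage by blast
  \<comment> \<open>A quotient map stays one over an open set. Continuity of \<open>\<kappa>\<close>
    can therefore be tested on pairs (z, f), where it is t f with t the translation from the section
    to z.\<close>
  have quo: "quotient_map (subtopology pairs ?V) (subtopology ?X ?W) orb"
    by (rule quotient_map_restriction[OF quotient_map_orb refl]) (use W in blast)
  have tV: "topspace (subtopology pairs ?V) = ?V" by auto
  have V1: "z \<in> topspace (total_space E) \<and> f \<in> topspace (Arr G) \<and> tgt G f = b \<and> proj E z \<in> U"
    if "(z, f) \<in> ?V" for z f
    using that proj_orb[of z f] by simp
  have kV: "k_space (subtopology pairs ?V)"
    using k_space_cgh[OF cgh_space_open_subtopology[OF cgh_pairs V]] .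
  have c1: "continuous_map (subtopology pairs ?V) (total_space E) fst"
    and c2: "continuous_map (subtopology pairs ?V) (Arr G) snd"
    using continuous_pairs continuous_map_from_subtopology by blast+
  have "continuous_map (subtopology pairs ?V) (subtopology B U) (proj E \<circ> fst)"
  proof (rule continuous_map_into_subtopology[OF continuous_map_compose[OF c1 E.continuous_proj]], rule Pi_I)
    fix x assume "x \<in> topspace (subtopology pairs ?V)"
    then have x: "(fst x, snd x) \<in> ?V" unfolding tV by simp
    show "(proj E \<circ> fst) x \<in> U" using V1[OF x] by simp
  qed
  from continuous_map_compose[OF this \<sigma>(1)]
  have c3: "continuous_map (subtopology pairs ?V) (total_space E) (\<lambda>x. \<sigma> (proj E (fst x)))"
    by (simp add: o_def)
  have "continuous_map (subtopology pairs ?V) (Arr (stabilizer G b))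
      (\<lambda>x. translation (stabilizer G b) E (\<sigma> (proj E (fst x))) (fst x))"
  proof (rule E.continuous_translation[OF kV c3 c1])
    fix x assume "x \<in> topspace (subtopology pairs ?V)"
    then have x: "(fst x, snd x) \<in> ?V" unfolding tV by simp
    show "proj E (\<sigma> (proj E (fst x))) = proj E (fst x)" using V1[OF x] \<sigma>(2) by simp
  qed
  then have "continuous_map (subtopology pairs ?V) (Arr G)
      (\<lambda>x. translation (stabilizer G b) E (\<sigma> (proj E (fst x))) (fst x))"
    by (simp add: continuous_map_in_subtopology)
  then have "continuous_map (subtopology pairs ?V) (Arr G)
      (\<lambda>x. gcomp G (translation (stabilizer G b) E (\<sigma> (proj E (fst x))) (fst x)) (snd x))"
  proof (rule continuous_gcomp[OF kV _ c2])
    fix x assume "x \<in> topspace (subtopology pairs ?V)"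
    then have x: "(fst x, snd x) \<in> ?V" unfolding tV by simp
    show "src G (translation (stabilizer G b) E (\<sigma> (proj E (fst x))) (fst x)) = tgt G (snd x)"
      using V1[OF x] \<sigma>(2) \<sigma>in translation_E(2) by simp
  qed
  then have "continuous_map (subtopology pairs ?V) (Arr G) (\<kappa> \<circ> orb)"
  proof (rule continuous_map_eq)
    fix x assume "x \<in> topspace (subtopology pairs ?V)"
    then have x: "(fst x, snd x) \<in> ?V" unfolding tV by simp
    have "\<kappa> (orb (fst x, snd x)) =
        gcomp G (translation (stabilizer G b) E (\<sigma> (proj E (fst x))) (fst x)) (snd x)"
      using V1[OF x] \<kappa>[of "fst x" "snd x"] by blast
    then show "gcomp G (translation (stabilizer G b) E (\<sigma> (proj E (fst x))) (fst x)) (snd x) = (\<kappa> \<circ> orb) x"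
      by simp
  qed
  then have "continuous_map (subtopology ?X ?W) (Arr G) \<kappa>"
    by (rule continuous_compose_quotient_map[OF quo])
  moreover have "\<kappa> c \<in> topspace (Arr G) \<and> tgt G (\<kappa> c) = b \<and> c = orb (\<sigma> (proj EG c), \<kappa> c)"
    if "c \<in> topspace ?X" "proj EG c \<in> U" for c
  proof -
    obtain z f where c: "c = orb (z, f)" and zf: "z \<in> topspace (total_space E)" "f \<in> topspace (Arr G)" "tgt G f = b"
      using EG_cases[OF \<open>c \<in> topspace ?X\<close>] .
    have "proj E z \<in> U" using that(2) unfolding c proj_orb[OF zf] .
    from conjunct2[OF \<kappa>[OF zf this]] show ?thesis unfolding c proj_orb[OF zf] .
  qed
  ultimately show thesis 
    using that[OF U \<sigma>(1), of \<kappa>] \<sigma>in \<sigma>(2) by blast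
qed

text \<open>Quotients of Hausdorff spaces need not be Hausdorff. Orbits over different base points
  are separated by the projection; different orbits over the same point have different fibre
  coordinates, which separate them inside a trivialising open set.\<close>

lemma cgh_EG: "cgh_space (total_space EG)"
  unfolding cgh_space_def
proof
  let ?X = "total_space EG"
  show "k_space ?X"
    using k_space_quotient_map_image[OF quotient_map_orb k_space_cgh[OF cgh_pairs]] .
  \<comment> \<open>A continuous map on an open set W, with Hausdorff target, separates in the whole
    space the points of W on which it differs.\<close>
  have sep: "\<exists>V V'. openin ?X V \<and> openin ?X V' \<and> c \<in> V \<and> c' \<in> V' \<and> disjnt V V'"
    if W: "openin ?X W" "c \<in> W" "c' \<in> W" and f: "continuous_map (subtopology ?X W) Y f"
      and Y: "Hausdorff_space Y" and ne: "f c \<noteq> f c'" for W c c' f and Y :: "'y topology"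
  proof -
    have tW: "topspace (subtopology ?X W) = W" using W(1) openin_subset by auto
    have "f c \<in> topspace Y" "f c' \<in> topspace Y"
      using continuous_map_into_topspace[OF f] tW W by blast+
    then obtain O1 O2 where O: "openin Y O1" "openin Y O2" "f c \<in> O1" "f c' \<in> O2" "disjnt O1 O2"
      using Y ne unfolding Hausdorff_space_def by blast
    have "openin ?X {w \<in> W. f w \<in> O'}" if "openin Y O'" for O'
      using openin_continuous_map_preimage[OF f that] W(1) openin_trans_full unfolding tW by blast
    then show ?thesis
      using O W by (intro exI[of _ "{w \<in> W. f w \<in> O1}"] exI[of _ "{w \<in> W. f w \<in> O2}"])
        (auto simp: disjnt_def)
  qed
  show "Hausdorff_space ?X"
    unfolding Hausdorff_space_def
  proof (intro allI impI, elim conjE)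
    fix c c' assume c: "c \<in> topspace ?X" "c' \<in> topspace ?X" "c \<noteq> c'"
    show "\<exists>V V'. openin ?X V \<and> openin ?X V' \<and> c \<in> V \<and> c' \<in> V' \<and> disjnt V V'"
    proof (cases "proj EG c = proj EG c'")
      case False
      have "continuous_map (subtopology ?X (topspace ?X)) B (proj EG)"
        using continuous_proj_EG by simp
      with False c show ?thesis
        using E.cgh_base unfolding cgh_space_def by (intro sep[OF openin_topspace]) auto
    next
      case True
      have m: "proj EG c \<in> topspace B"
      using continuous_map_into_topspace[OF continuous_proj_EG c(1)] .
      obtain U \<sigma> \<kappa> where U: "openin B U" "proj EG c \<in> U"
      and \<sigma>: "continuous_map (subtopology B U) (total_space E) \<sigma>"
      and \<kappa>: "continuous_map (subtopology ?X {c \<in> topspace ?X. proj EG c \<in> U}) (Arr G) \<kappa>"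
      and \<sigma>in [rule_format]: "\<forall>u\<in>U. \<sigma> u \<in> topspace (total_space E)"
      and "\<forall>u\<in>U. proj E (\<sigma> u) = u"
      and co [rule_format]: "\<forall>c\<in>topspace ?X. proj EG c \<in> U \<longrightarrow>
        \<kappa> c \<in> topspace (Arr G) \<and> tgt G (\<kappa> c) = b \<and> c = orb (\<sigma> (proj EG c), \<kappa> c)"
      using local_coordinates[OF m] .
      have "openin ?X {c \<in> topspace ?X. proj EG c \<in> U}"
        using continuous_proj_EG U(1) openin_continuous_map_preimage by blast
      moreover have "\<kappa> c \<noteq> \<kappa> c'" using co c True U(2) by metis
      ultimately show ?thesis
        using c True U(2) cgh_Arr unfolding cgh_space_def by (intro sep[OF _ _ _ \<kappa>]) auto
    qed
  qed
qed

text \<open>The computation [s, f] (f^-1 f') = [s, f'], with uniqueness from \<open>orb_inj\<close>.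
  It evaluates the description before \<open>EG\<close> is known to be a prebundle, so it can supply
  the division map for that proof.\<close>

lemma translation_orb:
  assumes s: "s \<in> topspace (total_space E)" and f: "f \<in> topspace (Arr G)" "tgt G f = b"
    and f': "f' \<in> topspace (Arr G)" "tgt G f' = b"
  shows "translation G EG (orb (s, f)) (orb (s, f')) = gcomp G (ginv G f) f'"
  unfolding translation_def
proof (rule the_equality)
  show "gcomp G (ginv G f) f' \<in> topspace (Arr G) \<and>
      anchor EG (orb (s, f)) = tgt G (gcomp G (ginv G f) f') \<and>
      act EG (orb (s, f)) (gcomp G (ginv G f) f') = orb (s, f')"
    using assms by (simp add: anchor_orb act_orb)
  fix g assume "g \<in> topspace (Arr G) \<and> anchor EG (orb (s, f)) = tgt G g \<and>
      act EG (orb (s, f)) g = orb (s, f')"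
  then have g: "g \<in> topspace (Arr G)" "src G f = tgt G g" and "act EG (orb (s, f)) g = orb (s, f')"
    using assms by (simp_all add: anchor_orb)
  then have "orb (s, gcomp G f g) = orb (s, f')" using act_orb[OF s f g] by simp
  then have "gcomp G f g = f'" using assms g by (intro orb_inj[OF s]) simp_all
  then show "g = gcomp G (ginv G f) f'" using f g by auto
qed

text \<open>Brings two orbits over one base point into the form that \<open>translation_orb\<close>
  treats.\<close>

lemma common_coordinates:
  assumes "p \<in> topspace (total_space EG)" "q \<in> topspace (total_space EG)" "proj EG p = proj EG q"
  obtains s f f' where "p = orb (s, f)" "q = orb (s, f')" "s \<in> topspace (total_space E)"
    "f \<in> topspace (Arr G)" "tgt G f = b" "f' \<in> topspace (Arr G)" "tgt G f' = b"
proof -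
  obtain s f where p: "p = orb (s, f)" "s \<in> topspace (total_space E)" "f \<in> topspace (Arr G)" "tgt G f = b"
    using EG_cases[OF assms(1)] .
  obtain z h where q: "q = orb (z, h)" "z \<in> topspace (total_space E)" "h \<in> topspace (Arr G)" "tgt G h = b"
    using EG_cases[OF assms(2)] .
  have sz: "proj E s = proj E z" using assms(3) p q by (simp add: proj_orb)
  let ?t = "translation (stabilizer G b) E s z"
  have "q = orb (s, gcomp G ?t h)" using orb_coordinates[of s z h] p q sz by simp
  then show thesis
    using that[OF p(1) _ p(2-4), of "gcomp G ?t h"] translation_E[OF p(2) q(2) sz] q by simp
qed

text \<open>In a trivialisation the action is composition on the fibre coordinate, c g =
  [\<sigma>, \<kappa>(c) g], and the division map is \<kappa>(p)^-1 \<kappa>(q). Both are continuous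
  there. Arguing in coordinates avoids having to know that the quotient map stays a quotient map on
  fibre products.\<close>

lemma prebundle_EG: "prebundle G B EG"
proof (rule prebundleI[where d = "translation G EG"])
  let ?X = "total_space EG"
  let ?D = "subtopology (kprod_topology ?X (Arr G)) {(c, g). anchor EG c = tgt G g}"
  have D: "cgh_space ?D"
    by (rule cgh_space_fibre_product[OF cgh_EG cgh_Arr Hausdorff_Obj continuous_anchor_EG continuous_tgt])
  have D1: "continuous_map ?D ?X fst" and D2: "continuous_map ?D (Arr G) snd"
    by (rule continuous_map_kprod_fst_sub continuous_map_kprod_snd_sub)+
  have pD: "continuous_map ?D B (\<lambda>x. proj EG (fst x))"
    using continuous_map_compose[OF D1 continuous_proj_EG] by (simp add: o_def)
  have inD: "fst x \<in> topspace ?X" "snd x \<in> topspace (Arr G)" "anchor EG (fst x) = tgt G (snd x)"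
    if "x \<in> topspace ?D" for x using that by auto
  have "continuous_map ?D ?X (\<lambda>x. act EG (fst x) (snd x))"
  proof (rule continuous_map_locally)
    fix x assume x: "x \<in> topspace ?D"
    have m: "proj EG (fst x) \<in> topspace B"
      using continuous_map_into_topspace[OF pD x] .
    obtain U \<sigma> \<kappa> where U: "openin B U" "proj EG (fst x) \<in> U"
      and \<sigma>: "continuous_map (subtopology B U) (total_space E) \<sigma>"
      and \<kappa>: "continuous_map (subtopology ?X {c \<in> topspace ?X. proj EG c \<in> U}) (Arr G) \<kappa>"
      and \<sigma>in [rule_format]: "\<forall>u\<in>U. \<sigma> u \<in> topspace (total_space E)"
      and "\<forall>u\<in>U. proj E (\<sigma> u) = u"
      and co [rule_format]: "\<forall>c\<in>topspace ?X. proj EG c \<in> U \<longrightarrow>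
        \<kappa> c \<in> topspace (Arr G) \<and> tgt G (\<kappa> c) = b \<and> c = orb (\<sigma> (proj EG c), \<kappa> c)"
      using local_coordinates[OF m] .
    define V where "V = {x \<in> topspace ?D. proj EG (fst x) \<in> U}"
    have V: "openin ?D V" unfolding V_def using pD U(1) by (rule openin_continuous_map_preimage)
    have tV: "topspace (subtopology ?D V) = V" by (auto simp: V_def)
    have inV: "fst x \<in> topspace ?X" "snd x \<in> topspace (Arr G)" "anchor EG (fst x) = tgt G (snd x)"
      "proj EG (fst x) \<in> U" if "x \<in> V" for x
      using that inD unfolding V_def by blast+
    have kV: "k_space (subtopology ?D V)"
      using k_space_cgh[OF cgh_space_open_subtopology[OF D V]] .
    have "continuous_map (subtopology ?D V) (subtopology B U) (\<lambda>x. proj EG (fst x))"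
      by (rule continuous_map_into_subtopology[OF continuous_map_from_subtopology[OF pD]])
         (use inV tV in blast)
    from continuous_map_compose[OF this \<sigma>]
    have c1: "continuous_map (subtopology ?D V) (total_space E) (\<lambda>x. \<sigma> (proj EG (fst x)))"
      by (simp add: o_def)
    have "continuous_map (subtopology ?D V) (subtopology ?X {c \<in> topspace ?X. proj EG c \<in> U}) fst"
      by (rule continuous_map_into_subtopology[OF continuous_map_from_subtopology[OF D1]])
         (use inV tV in blast)
    from continuous_map_compose[OF this \<kappa>]
    have c2: "continuous_map (subtopology ?D V) (Arr G) (\<lambda>x. \<kappa> (fst x))"
      by (simp add: o_def)
    \<comment> \<open>Makes \<open>\<kappa> c\<close> composable with exactly the arrows that act on
      c.\<close>
    have src: "src G (\<kappa> c) = anchor EG c" if "c \<in> topspace ?X" "proj EG c \<in> U" for c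
      using co[OF that] anchor_orb \<sigma>in[OF that(2)] by metis
    have "continuous_map (subtopology ?D V) (Arr G) (\<lambda>x. gcomp G (\<kappa> (fst x)) (snd x))"
      by (rule continuous_gcomp[OF kV c2 continuous_map_from_subtopology[OF D2]])
         (use src inV tV in metis)
    then have "continuous_map (subtopology ?D V) ?X
        (\<lambda>x. orb (\<sigma> (proj EG (fst x)), gcomp G (\<kappa> (fst x)) (snd x)))"
      by (rule continuous_map_orb[OF kV c1]) (use src inV tV co in simp)
    then have "continuous_map (subtopology ?D V) ?X (\<lambda>x. act EG (fst x) (snd x))"
    proof (rule continuous_map_eq)
      fix x assume "x \<in> topspace (subtopology ?D V)"
      then have x: "x \<in> V" unfolding tV .
      have "act EG (orb (\<sigma> (proj EG (fst x)), \<kappa> (fst x))) (snd x) =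
          orb (\<sigma> (proj EG (fst x)), gcomp G (\<kappa> (fst x)) (snd x))"
        using co inV[OF x] src \<sigma>in by (intro act_orb) auto
      then show "orb (\<sigma> (proj EG (fst x)), gcomp G (\<kappa> (fst x)) (snd x)) = act EG (fst x) (snd x)"
        using co inV[OF x] by metis
    qed
    then show "\<exists>U. openin ?D U \<and> x \<in> U \<and> continuous_map (subtopology ?D U) ?X (\<lambda>x. act EG (fst x) (snd x))"
      using V x U(2) by (intro exI[of _ V]) (simp add: V_def)
  qed
  then have act: "continuous_map ?D ?X (\<lambda>(c, g). act EG c g)" by (simp add: case_prod_unfold)
  have algebra: "anchor EG (act EG c g) = src G g \<and> proj EG (act EG c g) = proj EG c"
    "act EG c (idt G (anchor EG c)) = c"
    "h \<in> topspace (Arr G) \<Longrightarrow> src G g = tgt G h \<Longrightarrow> act EG (act EG c g) h = act EG c (gcomp G g h)"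
    if c0: "c \<in> topspace ?X" "g \<in> topspace (Arr G)" "anchor EG c = tgt G g" for c g h
  proof -
    obtain z f where c: "c = orb (z, f)" and z: "z \<in> topspace (total_space E)" "f \<in> topspace (Arr G)" "tgt G f = b"
      using EG_cases[OF c0(1)] .
    moreover have "src G f = tgt G g" using c0 c z by (simp add: anchor_orb)
    ultimately show "anchor EG (act EG c g) = src G g \<and> proj EG (act EG c g) = proj EG c"
      "act EG c (idt G (anchor EG c)) = c"
      "h \<in> topspace (Arr G) \<Longrightarrow> src G g = tgt G h \<Longrightarrow> act EG (act EG c g) h = act EG c (gcomp G g h)"
      using c0(2,3) by (simp_all add: act_orb anchor_orb proj_orb gcomp_assoc)
  qed
  have unit: "act EG c (idt G (anchor EG c)) = c" if "c \<in> topspace ?X" for c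
  proof -
    have "anchor EG c \<in> topspace (Obj G)" using continuous_map_into_topspace[OF continuous_anchor_EG that] .
    then show ?thesis using algebra(2)[OF that, of "idt G (anchor EG c)"] by simp
  qed
  show "topological_groupoid G" "cgh_space B" by (rule topological_groupoid E.cgh_base)+
  show "continuous_map ?X B (proj EG)" by (rule continuous_proj_EG)
  show "right_space G ?X (anchor EG) (act EG)"
    unfolding right_space_def
    using cgh_EG continuous_anchor_EG act algebra unit by blast
  show "admits_local_sections ?X B (proj EG)"
    unfolding admits_local_sections_def
  proof
    fix m assume "m \<in> topspace B"
    then obtain U \<sigma> where U: "openin B U" "m \<in> U"
      and \<sigma>: "continuous_map (subtopology B U) (total_space E) \<sigma>" "\<forall>u\<in>U. proj E (\<sigma> u) = u"
      using E.local_sections unfolding admits_local_sections_def by blast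
    have tU: "topspace (subtopology B U) = U" using U(1) openin_subset by auto
    \<comment> \<open>A section of E becomes one of \<open>EG\<close> along z \<mapsto>
      [z, id].\<close>
    have "continuous_map (subtopology B U) ?X (\<lambda>u. orb (\<sigma> u, idt G b))"
      using k_space_cgh[OF cgh_space_open_subtopology[OF E.cgh_base U(1)]] \<sigma>(1) base_point
      by (intro continuous_map_orb) auto
    moreover have "\<forall>u\<in>U. proj EG (orb (\<sigma> u, idt G b)) = u"
      using continuous_map_into_topspace[OF \<sigma>(1), unfolded tU] \<sigma>(2) base_point by (simp add: proj_orb)
    ultimately show "\<exists>U \<sigma>. openin B U \<and> m \<in> U \<and> continuous_map (subtopology B U) ?X \<sigma> \<and>
        (\<forall>u\<in>U. proj EG (\<sigma> u) = u)" using U by blast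
  qed
  show "proj EG (act EG p g) = proj EG p"
    if "p \<in> topspace ?X" "g \<in> topspace (Arr G)" "anchor EG p = tgt G g" for p g
    using algebra(1)[OF that] by simp
  show "tgt G (translation G EG p q) = anchor EG p \<and> act EG p (translation G EG p q) = q"
    if pq: "p \<in> topspace ?X" "q \<in> topspace ?X" "proj EG p = proj EG q" for p q
  proof -
    obtain s f f' where "p = orb (s, f)" "q = orb (s, f')" "s \<in> topspace (total_space E)"
      "f \<in> topspace (Arr G)" "tgt G f = b" "f' \<in> topspace (Arr G)" "tgt G f' = b"
      using common_coordinates[OF pq] .
    then show ?thesis by (simp add: translation_orb anchor_orb act_orb)
  qed
  show "translation G EG p (act EG p g) = g"
    if g: "p \<in> topspace ?X" "g \<in> topspace (Arr G)" "anchor EG p = tgt G g" for p g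
  proof -
    obtain z f where p: "p = orb (z, f)" and z: "z \<in> topspace (total_space E)" "f \<in> topspace (Arr G)" "tgt G f = b"
      using EG_cases[OF g(1)] .
    have "src G f = tgt G g" using g p z by (simp add: anchor_orb)
    then show ?thesis using g z by (simp add: p act_orb translation_orb)
  qed
  let ?F = "subtopology (kprod_topology ?X ?X) {(p, q). proj EG p = proj EG q}"
  have F: "cgh_space ?F"
    using E.cgh_base unfolding cgh_space_def[of B]
    by (intro cgh_space_fibre_product[OF cgh_EG cgh_EG _ continuous_proj_EG continuous_proj_EG]) blast
  have F1: "continuous_map ?F ?X fst" and F2: "continuous_map ?F ?X snd"
    by (rule continuous_map_kprod_fst_sub continuous_map_kprod_snd_sub)+
  have pF: "continuous_map ?F B (\<lambda>x. proj EG (fst x))"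
    using continuous_map_compose[OF F1 continuous_proj_EG] by (simp add: o_def)
  have inF: "fst x \<in> topspace ?X" "snd x \<in> topspace ?X" "proj EG (snd x) = proj EG (fst x)"
    if "x \<in> topspace ?F" for x using that by auto
  have "continuous_map ?F (Arr G) (\<lambda>x. translation G EG (fst x) (snd x))"
  proof (rule continuous_map_locally)
    fix x assume x: "x \<in> topspace ?F"
    have m: "proj EG (fst x) \<in> topspace B"
      using continuous_map_into_topspace[OF pF x] .
    obtain U \<sigma> \<kappa> where U: "openin B U" "proj EG (fst x) \<in> U"
      and \<sigma>: "continuous_map (subtopology B U) (total_space E) \<sigma>"
      and \<kappa>: "continuous_map (subtopology ?X {c \<in> topspace ?X. proj EG c \<in> U}) (Arr G) \<kappa>"
      and \<sigma>in [rule_format]: "\<forall>u\<in>U. \<sigma> u \<in> topspace (total_space E)"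
      and "\<forall>u\<in>U. proj E (\<sigma> u) = u"
      and co [rule_format]: "\<forall>c\<in>topspace ?X. proj EG c \<in> U \<longrightarrow>
        \<kappa> c \<in> topspace (Arr G) \<and> tgt G (\<kappa> c) = b \<and> c = orb (\<sigma> (proj EG c), \<kappa> c)"
      using local_coordinates[OF m] .
    define V where "V = {x \<in> topspace ?F. proj EG (fst x) \<in> U}"
    have V: "openin ?F V" unfolding V_def using pF U(1) by (rule openin_continuous_map_preimage)
    have tV: "topspace (subtopology ?F V) = V" by (auto simp: V_def)
    have inV: "fst x \<in> topspace ?X" "snd x \<in> topspace ?X" "proj EG (snd x) = proj EG (fst x)"
      "proj EG (fst x) \<in> U" "proj EG (snd x) \<in> U" if "x \<in> V" for x
      using that inF[of x] unfolding V_def by auto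
    have kV: "k_space (subtopology ?F V)"
      using k_space_cgh[OF cgh_space_open_subtopology[OF F V]] .
    have "continuous_map (subtopology ?F V) (subtopology ?X {c \<in> topspace ?X. proj EG c \<in> U}) fst"
      by (rule continuous_map_into_subtopology[OF continuous_map_from_subtopology[OF F1]])
         (use inV tV in blast)
    from continuous_map_compose[OF continuous_map_compose[OF this \<kappa>] continuous_ginv]
    have c1: "continuous_map (subtopology ?F V) (Arr G) (\<lambda>x. ginv G (\<kappa> (fst x)))"
      by (simp add: o_def)
    have "continuous_map (subtopology ?F V) (subtopology ?X {c \<in> topspace ?X. proj EG c \<in> U}) snd"
      by (rule continuous_map_into_subtopology[OF continuous_map_from_subtopology[OF F2]])
         (use inV tV in blast)
    from continuous_map_compose[OF this \<kappa>]
    have c2: "continuous_map (subtopology ?F V) (Arr G) (\<lambda>x. \<kappa> (snd x))"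
      by (simp add: o_def)
    have "continuous_map (subtopology ?F V) (Arr G) (\<lambda>x. gcomp G (ginv G (\<kappa> (fst x))) (\<kappa> (snd x)))"
      by (rule continuous_gcomp[OF kV c1 c2]) (use co inV tV in simp)
    then have "continuous_map (subtopology ?F V) (Arr G) (\<lambda>x. translation G EG (fst x) (snd x))"
    proof (rule continuous_map_eq)
      fix x assume "x \<in> topspace (subtopology ?F V)"
      then have x: "x \<in> V" unfolding tV .
      \<comment> \<open>Both points lie over the same base point, so both are written with one and
        the same first coordinate.\<close>
      have "translation G EG (orb (\<sigma> (proj EG (fst x)), \<kappa> (fst x))) (orb (\<sigma> (proj EG (fst x)), \<kappa> (snd x))) =
          gcomp G (ginv G (\<kappa> (fst x))) (\<kappa> (snd x))"
        using co inV[OF x] \<sigma>in by (intro translation_orb) auto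
      then show "gcomp G (ginv G (\<kappa> (fst x))) (\<kappa> (snd x)) = translation G EG (fst x) (snd x)"
        using co inV[OF x] by metis
    qed
    then show "\<exists>U. openin ?F U \<and> x \<in> U \<and> continuous_map (subtopology ?F U) (Arr G)
        (\<lambda>x. translation G EG (fst x) (snd x))"
      using V x U(2) by (intro exI[of _ V]) (simp add: V_def)
  qed
  then show "continuous_map ?F (Arr G) (\<lambda>(p, q). translation G EG p q)" by (simp add: case_prod_unfold)
qed

text \<open>Combines two facts in a single isomorphism: E is the anchor fibre of \<open>EG\<close>,
  and restriction to the anchor fibre commutes with pullback.\<close>

lemma pullback_anchor_fibre_EG:
  assumes M: "cgh_space M" and f: "continuous_map M B f"
    and ls: "admits_local_sections (arrows_from G b) (Obj G) (tgt G)"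
  shows "bundle_isomorphic (stabilizer G b) (pullback_bundle M f E) (anchor_fibre b (pullback_bundle M f EG))"
proof (rule bundle_isomorphicI[OF prebundle_pullback[OF prebundle_E M f]
      prebundle_anchor_fibre[OF prebundle_pullback[OF prebundle_EG M f] base_point ls],
      where \<phi> = "\<lambda>x. (fst x, orb (snd x, idt G b))"])
  let ?T = "total_space (pullback_bundle M f E)"
  have T: "k_space ?T"
    using prebundle.cgh_total[OF prebundle_pullback[OF prebundle_E M f]] k_space_cgh by blast
  have c1: "continuous_map ?T M fst" and c2: "continuous_map ?T (total_space E) snd"
    unfolding pullback_bundle_simps(1) by (rule continuous_map_kprod_fst_sub continuous_map_kprod_snd_sub)+
  have "continuous_map ?T (total_space EG) (\<lambda>x. orb (snd x, idt G b))"
    using base_point by (intro continuous_map_orb[OF T c2]) auto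
  then have "continuous_map ?T (kprod_topology M (total_space EG)) (\<lambda>x. (fst x, orb (snd x, idt G b)))"
    by (rule continuous_map_kprod_Pair[OF T c1])
  then show "continuous_map ?T (total_space (anchor_fibre b (pullback_bundle M f EG)))
      (\<lambda>x. (fst x, orb (snd x, idt G b)))"
    using base_point by (auto simp: continuous_map_in_subtopology proj_orb anchor_orb)
next
  fix x assume "x \<in> topspace (total_space (pullback_bundle M f E))"
  then have x: "snd x \<in> topspace (total_space E)" by auto
  show "proj (anchor_fibre b (pullback_bundle M f EG)) (fst x, orb (snd x, idt G b)) =
      proj (pullback_bundle M f E) x" by simp
  show "anchor (anchor_fibre b (pullback_bundle M f EG)) (fst x, orb (snd x, idt G b)) =
      anchor (pullback_bundle M f E) x"
    using x base_point by (simp add: anchor_orb)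
  fix k assume "k \<in> topspace (Arr (stabilizer G b))"
  then have k: "k \<in> topspace (Arr G)" "src G k = b" "tgt G k = b" by simp_all
  \<comment> \<open>Equivariance: [z k, id] = [z, k] = [z, id] k.\<close>
  have "orb (act E (snd x) k, idt G b) = act EG (orb (snd x, idt G b)) k"
    using x k base_point orb_act[of "snd x" "idt G b" k] act_orb[of "snd x" "idt G b" k] by simp
  then show "(fst (act (pullback_bundle M f E) x k), orb (snd (act (pullback_bundle M f E) x k), idt G b)) =
      act (anchor_fibre b (pullback_bundle M f EG)) (fst x, orb (snd x, idt G b)) k"
    by simp
qed

end

section \<open>Classification\<close>

text \<open>P may live on any type and may be a mere prebundle, as pullbacks of \<open>EG\<close>
  do; only the members Q use the type on which \<open>iso_classes\<close> is formed. For P without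
  paracompact total space the set is empty.\<close>

definition bundle_class ::
  "('o, 'g) groupoid \<Rightarrow> 'm topology \<Rightarrow> ('p, 'm, 'o, 'g) gbundle \<Rightarrow> ('m \<times> 'g, 'm, 'o, 'g) gbundle set" where
  "bundle_class G M P = {Q. principal_bundle G M Q \<and> bundle_isomorphic G Q P}"

context top_groupoid
begin

lemmas principal_imp_prebundle = principal_bundle_imp_prebundle[OF topological_groupoid]

lemma bundle_class_nonempty:
  assumes P: "principal_bundle G M P"
  shows "\<exists>Q. Q \<in> bundle_class G M P"
proof -
  obtain Q :: "('a \<times> 'g, 'a, 'o, 'g) gbundle" where Q: "principal_bundle G M Q" "bundle_isomorphic G P Q"
    using principal_bundle_representative[OF P] by blast
  then have "bundle_isomorphic G Q P"
    using bundle_isomorphic_sym principal_imp_prebundle P by metis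
  with Q show ?thesis by (auto simp: bundle_class_def)
qed

lemma bundle_class_cong:
  assumes "prebundle G M P" "prebundle G M P'" "bundle_isomorphic G P P'"
  shows "bundle_class G M P = bundle_class G M P'"
  using assms bundle_isomorphic_trans[of G _ P P'] bundle_isomorphic_trans[of G _ P' P]
    bundle_isomorphic_sym[of G M P P'] unfolding bundle_class_def by blast

lemma bundle_class_eq_iff:
  assumes P: "principal_bundle G M P" and P': "principal_bundle G M P'"
  shows "bundle_class G M P = bundle_class G M P' \<longleftrightarrow> bundle_isomorphic G P P'"
proof
  assume eq: "bundle_class G M P = bundle_class G M P'"
  obtain Q where "Q \<in> bundle_class G M P" using bundle_class_nonempty[OF P] by blast
  moreover with eq have "Q \<in> bundle_class G M P'" by simp
  ultimately have Q: "principal_bundle G M Q" "bundle_isomorphic G Q P" "bundle_isomorphic G Q P'"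
    by (auto simp: bundle_class_def)
  then show "bundle_isomorphic G P P'"
    using bundle_isomorphic_sym[OF principal_imp_prebundle[OF Q(1)] principal_imp_prebundle[OF P]]
      bundle_isomorphic_trans by metis
qed (use bundle_class_cong principal_imp_prebundle P P' in metis)

lemma iso_class_eq:
  fixes P :: "('m \<times> 'g, 'm, 'o, 'g) gbundle"
  assumes "principal_bundle G M P"
  shows "{(P, Q). principal_bundle G M P \<and> principal_bundle G M Q \<and> bundle_isomorphic G P Q} `` {P}
     = bundle_class G M P"
  using assms bundle_isomorphic_sym[OF principal_imp_prebundle principal_imp_prebundle]
  unfolding bundle_class_def by auto

lemma iso_classes_eq:
  fixes M :: "'m topology"
  shows "iso_classes G M = bundle_class G M `
     {P :: ('m \<times> 'g, 'm, 'o, 'g) gbundle. principal_bundle G M P}"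
  unfolding iso_classes_def quotient_def using iso_class_eq by auto

lemma bundle_class_in:
  assumes P: "principal_bundle G M P"
  shows "bundle_class G M P \<in> iso_classes G M"
proof -
  obtain Q where Q: "Q \<in> bundle_class G M P" using bundle_class_nonempty[OF P] by blast
  then have "principal_bundle G M Q" "bundle_isomorphic G Q P" by (auto simp: bundle_class_def)
  then have "principal_bundle G M Q" "bundle_class G M Q = bundle_class G M P"
    using bundle_class_eq_iff P by blast+
  then show ?thesis unfolding iso_classes_eq by blast
qed

lemma pullback_class_eq:
  assumes P: "principal_bundle G M P" and N: "cgh_space N" and F: "continuous_map N M F"
  shows "pullback_class G N F (bundle_class G M P) = bundle_class G N (pullback_bundle N F P)"
proof -
  have eq: "bundle_class G N (pullback_bundle N F P') = bundle_class G N (pullback_bundle N F P)"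
    if "P' \<in> bundle_class G M P" for P'
  proof -
    have P': "prebundle G M P'" "bundle_isomorphic G P' P"
      using that principal_imp_prebundle by (auto simp: bundle_class_def)
    note P0 = principal_imp_prebundle[OF P]
    show ?thesis
      by (rule bundle_class_cong[OF prebundle_pullback[OF P'(1) N F] prebundle_pullback[OF P0 N F]
            pullback_bundle_isomorphic[OF P'(1) P0 N F P'(2)]])
  qed
  have "pullback_class G N F (bundle_class G M P) =
      (\<Union>P'\<in>bundle_class G M P. bundle_class G N (pullback_bundle N F P'))"
    unfolding pullback_class_def bundle_class_def by blast
  \<comment> \<open>All sets in the union are equal, and there is at least one because P has a
    representative on the right type.\<close>
  also have "\<dots> = bundle_class G N (pullback_bundle N F P)"
    using eq bundle_class_nonempty[OF P] by blast
  finally show ?thesis .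
qed

end

section \<open>Homotopy classes under precomposition\<close>

lemma homotopy_classes_eq:
  "homotopy_classes M B = (\<lambda>f. {h. homotopic_with (\<lambda>_. True) M B f h}) ` {f. continuous_map M B f}"
  unfolding homotopy_classes_def quotient_def by auto

lemma homotopy_class_eqI:
  assumes "homotopic_with (\<lambda>_. True) M B f h"
  shows "{k. homotopic_with (\<lambda>_. True) M B f k} = {k. homotopic_with (\<lambda>_. True) M B h k}"
  using assms homotopic_with_trans homotopic_with_symD by blast

lemma precomp_class_eq:
  assumes f: "continuous_map M B f" and F: "continuous_map N M F"
  shows "precomp_class N B F {h. homotopic_with (\<lambda>_. True) M B f h} =
    {h. homotopic_with (\<lambda>_. True) N B (f \<circ> F) h}"
proof -
  have "homotopic_with (\<lambda>_. True) N B (f \<circ> F) (f' \<circ> F)" if "homotopic_with (\<lambda>_. True) M B f f'" for f'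
    using homotopic_with_compose_continuous_map_right[OF that F] by simp
  moreover have "homotopic_with (\<lambda>_. True) M B f f" using f by simp
  ultimately show ?thesis
    unfolding precomp_class_def using homotopic_with_trans by blast
qed

text \<open>Treats one base at a time: \<open>universal_bundle\<close> ranges over the bases on a
  single type, so the theorem uses this locale once for M and once for N.\<close>

locale classifying_bundle = stabilizer_bundle G b B E
  for G :: "('o, 'g) groupoid" and b and B :: "'b topology" and E :: "('e, 'b, 'o, 'g) gbundle" +
  fixes M :: "'m topology"
  assumes local_sections_tgt: "admits_local_sections (arrows_from G b) (Obj G) (tgt G)"
    and universal: "universal_bundle TYPE('m) (stabilizer G b) B E"
    and base_M: "base_space M"
begin

lemma cgh_M: "cgh_space M" using base_M by (simp add: base_space_def)

lemma prebundle_pullback_EG: "continuous_map M B f \<Longrightarrow> prebundle G M (pullback_bundle M f EG)"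
  using prebundle_pullback[OF prebundle_EG cgh_M] .

text \<open>The bridge between the two classifications; P may be a prebundle, so that it can itself
  be a pullback of \<open>EG\<close>.\<close>

lemma pullback_EG_iso_iff:
  assumes P: "prebundle G M P" and f: "continuous_map M B f"
  shows "bundle_isomorphic G P (pullback_bundle M f EG) \<longleftrightarrow>
    bundle_isomorphic (stabilizer G b) (anchor_fibre b P) (pullback_bundle M f E)"
proof -
  note iso = pullback_anchor_fibre_EG[OF cgh_M f local_sections_tgt]
  have iso': "bundle_isomorphic (stabilizer G b) (anchor_fibre b (pullback_bundle M f EG)) (pullback_bundle M f E)"
    by (rule bundle_isomorphic_sym[OF prebundle_pullback[OF prebundle_E cgh_M f]
          prebundle_anchor_fibre[OF prebundle_pullback_EG[OF f] base_point local_sections_tgt] iso])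
  show ?thesis
    unfolding anchor_fibre_isomorphic_iff[OF P prebundle_pullback_EG[OF f] base_point local_sections_tgt, symmetric]
    using bundle_isomorphic_trans[OF _ iso] bundle_isomorphic_trans[OF _ iso'] by blast
qed

text \<open>The second clause of \<open>universal_bundle\<close> compares pullbacks of E along
  arbitrary maps, so no paracompactness of pullbacks enters.\<close>

lemma pullback_EG_homotopic_iff:
  assumes f: "continuous_map M B f" and h: "continuous_map M B h"
  shows "bundle_isomorphic G (pullback_bundle M f EG) (pullback_bundle M h EG) \<longleftrightarrow>
    homotopic_with (\<lambda>_. True) M B f h"
proof -
  note iso = pullback_anchor_fibre_EG[OF cgh_M f local_sections_tgt]
  have iso': "bundle_isomorphic (stabilizer G b) (anchor_fibre b (pullback_bundle M f EG)) (pullback_bundle M f E)"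
    by (rule bundle_isomorphic_sym[OF prebundle_pullback[OF prebundle_E cgh_M f]
          prebundle_anchor_fibre[OF prebundle_pullback_EG[OF f] base_point local_sections_tgt] iso])
  have "bundle_isomorphic G (pullback_bundle M f EG) (pullback_bundle M h EG) \<longleftrightarrow>
      bundle_isomorphic (stabilizer G b) (pullback_bundle M f E) (pullback_bundle M h E)"
    unfolding pullback_EG_iso_iff[OF prebundle_pullback_EG[OF f] h]
    using bundle_isomorphic_trans[OF iso] bundle_isomorphic_trans[OF iso'] by blast
  then show ?thesis using universal base_M f h unfolding universal_bundle_def by blast
qed

text \<open>The existence clause of \<open>universal_bundle\<close> demands a genuine principal
  bundle. The anchor fibre of P is one, being closed in a paracompact space.\<close>

lemma ex_classifying_map:
  assumes P: "principal_bundle G M P"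
  shows "\<exists>f. continuous_map M B f \<and> bundle_isomorphic G P (pullback_bundle M f EG)"
proof -
  note P0 = principal_imp_prebundle[OF P]
  interpret P: prebundle G M P by (rule P0)
  interpret Pb: prebundle "stabilizer G b" M "anchor_fibre b P"
    by (rule prebundle_anchor_fibre[OF P0 base_point local_sections_tgt])
  have "closedin (total_space P) {p \<in> topspace (total_space P). anchor P p = b}"
    using base_point by (intro closedin_continuous_maps_eq[OF Hausdorff_Obj P.continuous_anchor]) auto
  moreover have "{p \<in> topspace (total_space P). anchor P p = b} =
      topspace (total_space P) \<inter> {p. anchor P p = b}" by auto
  moreover have "paracompact_space (total_space P)" using P by (simp add: principal_bundle_def)
  ultimately have "paracompact_space (total_space (anchor_fibre b P))"
    using paracompact_space_closed_subtopology subtopology_restrict by (metis anchor_fibre_simps(1))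
  then have Pb: "principal_bundle (stabilizer G b) M (anchor_fibre b P)"
    by (rule Pb.principal_bundle[OF base_M])
  \<comment> \<open>The universal property speaks of bundles on this type only, so the anchor fibre
    is first replaced by an isomorphic copy.\<close>
  obtain Q :: "('m \<times> 'g, 'm, 'o, 'g) gbundle" where Q: "principal_bundle (stabilizer G b) M Q"
    "bundle_isomorphic (stabilizer G b) (anchor_fibre b P) Q"
    using principal_bundle_representative[OF Pb] by blast
  then obtain f where f: "continuous_map M B f" "bundle_isomorphic (stabilizer G b) Q (pullback_bundle M f E)"
    using universal base_M unfolding universal_bundle_def by blast
  then have "bundle_isomorphic G P (pullback_bundle M f EG)"
    unfolding pullback_EG_iso_iff[OF P0 f(1)] using Q(2) bundle_isomorphic_trans by blast
  with f(1) show ?thesis by blast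
qed

lemma classifying_class_eq:
  assumes f: "continuous_map M B f"
  shows "classifying_class G M EG {h. homotopic_with (\<lambda>_. True) M B f h} =
    bundle_class G M (pullback_bundle M f EG)"
proof -
  have eq: "bundle_class G M (pullback_bundle M h EG) = bundle_class G M (pullback_bundle M f EG)"
    if "homotopic_with (\<lambda>_. True) M B f h" for h
  proof -
    have h: "continuous_map M B h" using that homotopic_with_imp_continuous_maps by blast
    then show ?thesis
      using bundle_class_cong[OF prebundle_pullback_EG[OF f] prebundle_pullback_EG[OF h]]
        pullback_EG_homotopic_iff[OF f h] that by simp
  qed
  have "classifying_class G M EG {h. homotopic_with (\<lambda>_. True) M B f h} =
      (\<Union>h\<in>{h. homotopic_with (\<lambda>_. True) M B f h}. bundle_class G M (pullback_bundle M h EG))"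
    unfolding classifying_class_def bundle_class_def by blast
  also have "\<dots> = bundle_class G M (pullback_bundle M f EG)"
    using eq f by (auto simp del: homotopic_with_refl intro: homotopic_with_refl[THEN iffD2])
  finally show ?thesis .
qed

lemma principal_pullback_EG:
  assumes "paracompact_pullbacks M B EG" and f: "continuous_map M B f"
  shows "principal_bundle G M (pullback_bundle M f EG)"
proof (rule prebundle.principal_bundle[OF prebundle_pullback_EG[OF f] base_M])
  show "paracompact_space (total_space (pullback_bundle M f EG))"
    using assms unfolding paracompact_pullbacks_def by blast
qed

text \<open>Injectivity is uniqueness up to homotopy and surjectivity is existence of classifying
  maps. The hypothesis \<open>pc\<close> makes each pullback of \<open>EG\<close> principal, so that
  its class is nonempty and belongs to \<open>iso_classes\<close>.\<close>

lemma classifying_class_bij: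
  assumes pc: "paracompact_pullbacks M B EG"
  shows "bij_betw (classifying_class G M EG) (homotopy_classes M B) (iso_classes G M)"
  unfolding bij_betw_def
proof
  note principal = principal_pullback_EG[OF pc]
  show "inj_on (classifying_class G M EG) (homotopy_classes M B)"
  proof (rule inj_onI)
    fix c d assume "c \<in> homotopy_classes M B" "d \<in> homotopy_classes M B"
      and eq: "classifying_class G M EG c = classifying_class G M EG d"
    then obtain f h where f: "continuous_map M B f" "c = {k. homotopic_with (\<lambda>_. True) M B f k}"
      and h: "continuous_map M B h" "d = {k. homotopic_with (\<lambda>_. True) M B h k}"
      unfolding homotopy_classes_eq by auto
    then have "bundle_class G M (pullback_bundle M f EG) = bundle_class G M (pullback_bundle M h EG)"
      using eq classifying_class_eq by simp
    then have "homotopic_with (\<lambda>_. True) M B f h"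
      using bundle_class_eq_iff[OF principal principal] pullback_EG_homotopic_iff f(1) h(1) by blast
    then show "c = d" using homotopy_class_eqI f(2) h(2) by simp
  qed
  show "classifying_class G M EG ` homotopy_classes M B = iso_classes G M"
  proof (rule antisym)
    show "classifying_class G M EG ` homotopy_classes M B \<subseteq> iso_classes G M"
      unfolding homotopy_classes_eq using classifying_class_eq bundle_class_in[OF principal] by auto
    show "iso_classes G M \<subseteq> classifying_class G M EG ` homotopy_classes M B"
    proof
      fix c assume "c \<in> iso_classes G M"
      then obtain P :: "('m \<times> 'g, 'm, 'o, 'g) gbundle"
        where P: "principal_bundle G M P" "c = bundle_class G M P"
        unfolding iso_classes_eq by blast
      then obtain f where f: "continuous_map M B f" "bundle_isomorphic G P (pullback_bundle M f EG)"
        using ex_classifying_map by blast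
      then have "c = classifying_class G M EG {h. homotopic_with (\<lambda>_. True) M B f h}"
        using P bundle_class_eq_iff[OF P(1) principal] classifying_class_eq by simp
      then show "c \<in> classifying_class G M EG ` homotopy_classes M B"
        unfolding homotopy_classes_eq using f(1) by blast
    qed
  qed
qed

end

theorem proposition5p7:
  fixes G :: "('o, 'g) groupoid" and b :: 'o
    and B :: "'b topology" and E :: "('e, 'b, 'o, 'g) gbundle"
    and M :: "'m topology" and N :: "'n topology"
  assumes "topological_groupoid G" and "transitive_groupoid G" and "compact_stabilizers G"
    and "b \<in> topspace (Obj G)"
    and "admits_local_sections (arrows_from G b) (Obj G) (tgt G)"
    and "universal_bundle TYPE('m) (stabilizer G b) B E"
    and "universal_bundle TYPE('n) (stabilizer G b) B E"
    and "base_space M" and "base_space N"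
  shows
    "(\<forall>P :: ('p, 'm, 'o, 'g) gbundle. principal_bundle G M P \<longrightarrow>
        (\<exists>f. continuous_map M B f \<and>
             bundle_isomorphic G P (pullback_bundle M f (associated_bundle G b E)))) \<and>
     (paracompact_pullbacks M B (associated_bundle G b E) \<longrightarrow>
        bij_betw (classifying_class G M (associated_bundle G b E))
          (homotopy_classes M B) (iso_classes G M)) \<and>
     (paracompact_pullbacks M B (associated_bundle G b E) \<longrightarrow>
      paracompact_pullbacks N B (associated_bundle G b E) \<longrightarrow>
        bij_betw (classifying_class G M (associated_bundle G b E))
          (homotopy_classes M B) (iso_classes G M) \<and>
        bij_betw (classifying_class G N (associated_bundle G b E))
          (homotopy_classes N B) (iso_classes G N) \<and>
        (\<forall>F. continuous_map N M F \<longrightarrow>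
           pullback_class G N F ` iso_classes G M \<subseteq> iso_classes G N \<and>
           precomp_class N B F ` homotopy_classes M B \<subseteq> homotopy_classes N B \<and>
           (\<forall>c\<in>homotopy_classes M B.
              pullback_class G N F (classifying_class G M (associated_bundle G b E) c) =
              classifying_class G N (associated_bundle G b E) (precomp_class N B F c))))"
proof -
  interpret top_groupoid G by unfold_locales (rule assms)
  have E: "prebundle (stabilizer G b) B E"
    using assms(6) principal_bundle_imp_prebundle[OF topological_groupoid_stabilizer[OF assms(4)]]
    unfolding universal_bundle_def by blast
  interpret EM: classifying_bundle G b B E M
    by (intro classifying_bundle.intro stabilizer_bundle.intro stabilizer_bundle_axioms.intro
          classifying_bundle_axioms.intro top_groupoid_axioms E assms)
  interpret EN: classifying_bundle G b B E N
    by (intro classifying_bundle.intro stabilizer_bundle.intro stabilizer_bundle_axioms.intro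
          classifying_bundle_axioms.intro top_groupoid_axioms E assms)
  let ?EG = "associated_bundle G b E"
  have natural: "pullback_class G N F (classifying_class G M ?EG c) =
      classifying_class G N ?EG (precomp_class N B F c)"
    if pc: "paracompact_pullbacks M B ?EG" and F: "continuous_map N M F"
      and c: "c \<in> homotopy_classes M B" for F c
  proof -
    obtain f where f: "continuous_map M B f" "c = {h. homotopic_with (\<lambda>_. True) M B f h}"
      using c unfolding homotopy_classes_eq by blast
    note fF = continuous_map_compose[OF F f(1)]
    have "pullback_class G N F (classifying_class G M ?EG c) =
        bundle_class G N (pullback_bundle N F (pullback_bundle M f ?EG))"
      using pullback_class_eq[OF EM.principal_pullback_EG[OF pc f(1)] EN.cgh_M F]
      by (simp add: f(2) EM.classifying_class_eq[OF f(1)])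
    also have "\<dots> = bundle_class G N (pullback_bundle N (f \<circ> F) ?EG)"
      by (rule bundle_class_cong[OF prebundle_pullback[OF EM.prebundle_pullback_EG[OF f(1)] EN.cgh_M F]
            EN.prebundle_pullback_EG[OF fF]
            pullback_bundle_comp[OF EM.prebundle_EG EM.cgh_M f(1) EN.cgh_M F]])
    also have "\<dots> = classifying_class G N ?EG (precomp_class N B F c)"
      by (simp add: f(2) precomp_class_eq[OF f(1) F] EN.classifying_class_eq[OF fF])
    finally show ?thesis .
  qed
  have precomp: "precomp_class N B F ` homotopy_classes M B \<subseteq> homotopy_classes N B"
    if F: "continuous_map N M F" for F
  proof
    fix d assume "d \<in> precomp_class N B F ` homotopy_classes M B"
    then obtain f where f: "continuous_map M B f"
      and "d = precomp_class N B F {h. homotopic_with (\<lambda>_. True) M B f h}"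
      unfolding homotopy_classes_eq by blast
    then have "d = {h. homotopic_with (\<lambda>_. True) N B (f \<circ> F) h}" using precomp_class_eq[OF f F] by simp
    then show "d \<in> homotopy_classes N B"
      unfolding homotopy_classes_eq using continuous_map_compose[OF F f] by blast
  qed
  \<comment> \<open>The pullback of an arbitrary P along F is not visibly paracompact. Instead the
    class of P is written as the class of a map f; naturality turns its pullback into the class of
    \<open>f \<circ> F\<close>, and \<open>pN\<close> places that in
    \<open>iso_classes G N\<close>.\<close>
  have "pullback_class G N F ` iso_classes G M \<subseteq> iso_classes G N"
    if pM: "paracompact_pullbacks M B ?EG" and pN: "paracompact_pullbacks N B ?EG"
      and F: "continuous_map N M F" for F
  proof
    fix d assume "d \<in> pullback_class G N F ` iso_classes G M"
    then obtain e where e: "e \<in> iso_classes G M" "d = pullback_class G N F e" by (rule imageE)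
    from e(1)[folded bij_betw_imp_surj_on[OF EM.classifying_class_bij[OF pM]]]
    obtain c where c: "e = classifying_class G M ?EG c" "c \<in> homotopy_classes M B" by (rule imageE)
    have "d = classifying_class G N ?EG (precomp_class N B F c)"
      using e(2) natural[OF pM F c(2)] unfolding c(1) by (rule trans)
    moreover have "precomp_class N B F c \<in> homotopy_classes N B"
      by (rule subsetD[OF precomp[OF F] imageI[OF c(2)]])
    ultimately show "d \<in> iso_classes G N"
      using bij_betw_apply[OF EN.classifying_class_bij[OF pN]] by simp
  qed
  moreover have "\<exists>f. continuous_map M B f \<and> bundle_isomorphic G P (pullback_bundle M f ?EG)"
    if "principal_bundle G M P" for P :: "('p, 'm, 'o, 'g) gbundle"
    using EM.ex_classifying_map[OF that] .
  ultimately show ?thesis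
    using EM.classifying_class_bij EN.classifying_class_bij natural precomp
    by simp
qed

end
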